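(* There exist an absolute constant $c>0$ and an integer $n_0$ such that for every $n \ge n_0$, the number of distinct sets $\mathcal{S}(G)$, as $G$ ranges over all (simple) graphs with $n$ vertices, is at most $2^{\,n - c\sqrt{n}/\log^{3/2}(n)}$. In asymptotic notation: the number of different cycle sets of $n$-vertex graphs is at most $2^{n - \Omega(\sqrt{n}/\log^{3/2}(n))}$.
   Context: For a graph $G$ with $n$ vertices, its cycle set $\mathcal{S}(G) \subseteq \{3,\ldots,n\}$ is defined by: $\ell \in \mathcal{S}(G)$ if and only if $G$ contains a cycle with exactly $\ell$ vertices. *)

theory Defs
  imports Complex_Main "Graph_Theory.Graph_Theory"
begin

text \<open>
  A simple graph is a \<^const>\<open>pair_graph\<close>: a finite, loop-free, symmetric digraph whose arcs are pairs
  of vertices. The bound \<open>3 \<le> length p\<close> is needed because in a symmetric digraph an edge traversed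
  back and forth counts as a cycle of length two. The number of arcs of a cycle equals its number
  of vertices, see \<open>cycle_set_iff_card_verts\<close>.
\<close>

definition cycle_set :: "'a pair_pre_digraph \<Rightarrow> nat set" where
  "cycle_set G = {length p | p. pre_digraph.cycle (with_proj G) p \<and> 3 \<le> length p}"

text \<open>
  Every graph with \<open>n\<close> vertices is isomorphic to one whose vertices are natural numbers, so this
  collects the cycle sets of all graphs with \<open>n\<close> vertices.
\<close>

definition cycle_sets :: "nat \<Rightarrow> nat set set" where
  "cycle_sets n = {cycle_set G | G :: nat pair_pre_digraph. pair_graph G \<and> card (pverts G) = n}"

lemma (in wf_digraph) card_verts_cycle:
  assumes "awalk u p u" "distinct (tl (awalk_verts u p))" "p \<noteq> []"
  shows "card (set (awalk_verts u p)) = length p"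
proof -
  obtain x xs where xs: "awalk_verts u p = x # xs"
    by (cases "awalk_verts u p") (simp_all add: awalk_verts_non_Nil)
  have len: "length xs = length p"
    using length_awalk_verts[of u p] xs by simp
  then have "xs \<noteq> []" using assms(3) by (metis length_0_conv)
  moreover have "hd (awalk_verts u p) = u" "last (awalk_verts u p) = u"
    using assms(1) by (blast elim: awalkE)+
  ultimately have "x \<in> set xs" using xs by (metis last_ConsR last_in_set list.sel(1))
  then have "set (awalk_verts u p) = set xs" unfolding xs by (simp add: insert_absorb)
  moreover have "card (set xs) = length xs" using assms(2) xs by (simp add: distinct_card)
  ultimately show ?thesis using len by (simp only:)
qed

lemma cycle_set_iff_card_verts:
  assumes "pair_graph G"
  shows "l \<in> cycle_set G \<longleftrightarrow> 3 \<le> l \<and>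
    (\<exists>u p. pre_digraph.awalk (with_proj G) u p u
         \<and> distinct (tl (pre_digraph.awalk_verts (with_proj G) u p)) \<and> p \<noteq> []
         \<and> card (set (pre_digraph.awalk_verts (with_proj G) u p)) = l)"
proof -
  interpret pair_graph G by fact
  show ?thesis
    unfolding cycle_set_def pre_digraph.cycle_def mem_Collect_eq
    by (metis wf_digraph.card_verts_cycle wf_digraph_axioms)
qed

lemma cycle_set_subset:
  assumes "pair_graph G"
  shows "cycle_set G \<subseteq> {3..card (pverts G)}"
proof
  interpret pair_graph G by fact
  fix l assume "l \<in> cycle_set G"
  then obtain u p where l: "3 \<le> l" "pre_digraph.awalk (with_proj G) u p u"
    "card (set (pre_digraph.awalk_verts (with_proj G) u p)) = l"
    unfolding cycle_set_iff_card_verts[OF assms] by metis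
  have "set (pre_digraph.awalk_verts (with_proj G) u p) \<subseteq> pverts G"
    using l(2) by (rule awalkE) simp
  then have "l \<le> card (pverts G)"
    unfolding l(3)[symmetric] by (rule card_mono[OF pair_finite_verts])
  then show "l \<in> {3..card (pverts G)}" using l(1) by simp
qed

lemma finite_cycle_sets: "finite (cycle_sets n)"
proof (rule finite_subset)
  show "cycle_sets n \<subseteq> Pow {3..n}"
    unfolding cycle_sets_def using cycle_set_subset by fastforce
qed simp

end

theory Submission
  imports Defs "HOL-Library.Discrete_Functions" "HOL-Real_Asymp.Real_Asymp"
begin

text \<open>
  If \<open>S\<close> contains a set \<open>B\<close> with \<open>g\<close> elements that can be described with \<open>b\<close> bits, then there are
  at most \<open>2 ^ (n + b - g)\<close> possibilities for \<open>S\<close>; so it suffices to find such a \<open>B\<close> with \<open>g - b\<close> of order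
  \<open>k = sqrt n / log\<^bsup>3/2\<^esup> n\<close> in every cycle set, up to few exceptions. The exceptions are the graphs
  without a cycle of length \<open>l > n - k\<close> and those with at most \<open>n / (8 log n)\<close> edges outside such a cycle.

  In the remaining graphs either a vertex outside the cycle has many neighbours on it, and all
  differences between their positions give cycle lengths, or the cycle has many chords. Group the
  chords by length (within a factor \<open>2\<close>) and position, such that the chords of a group pass over a
  common point and different groups lie in disjoint windows, and keep \<open>N\<close> groups of about
  equal size \<open>\<tau>\<close>, where \<open>N * \<tau>\<close> is of order at least \<open>n / log\<^sup>3 n\<close>. A group contains \<open>sqrt \<tau>\<close> pairwise
  nested or pairwise crossing chords. Two of these always form a cycle whose length is
  the difference of their lengths, or of the sums of their end points, plus \<open>2\<close>; this is enough if
  \<open>N = 1\<close>. They also give about \<open>sqrt \<tau>\<close> ways to shorten the big cycle inside the window, and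
  the reductions in different windows add up. Pairing up the windows, \<open>q\<close> elements each of two
  sets of \<open>2 q\<^sup>2\<close> reductions already have \<open>q\<^sup>2 / 2\<close> sums, so that the description is short
  unless \<open>\<tau>\<close> is polylogarithmic; in that case many disjoint chords of the same length yield a long
  arithmetic progression of cycle lengths.
\<close>

section \<open>Sumsets, chains and counting\<close>

text \<open>The elements of \<open>X'\<close> are chosen greedily. As long as fewer than
  \<open>q\<close> are chosen, at most \<open>q\<^sup>2\<close> values are reached, and double
  counting finds an \<open>x\<close> for which at least half of the values \<open>f x y\<close> are
  new. The point is that at most \<open>2 * q\<close> elements describe an image of quadratic
  size.\<close>

lemma sumset_of_few_elements:
  fixes f :: "'a \<Rightarrow> 'b \<Rightarrow> 'c"
  assumes X: "finite X" "2 * q\<^sup>2 \<le> card X" and Y: "finite Y" "card Y = q"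
    and inj1: "\<And>y. y \<in> Y \<Longrightarrow> inj_on (\<lambda>x. f x y) X"
    and inj2: "\<And>x. x \<in> X \<Longrightarrow> inj_on (f x) Y"
  shows "\<exists>X'\<subseteq>X. card X' \<le> q \<and> q\<^sup>2 \<le> 2 * card (case_prod f ` (X' \<times> Y))"
proof -
  have "\<exists>X'\<subseteq>X. card X' \<le> j \<and> j * q \<le> 2 * card (case_prod f ` (X' \<times> Y))" if "j \<le> q" for j
    using that
  proof (induction j)
    case 0
    show ?case by (intro exI[of _ "{}"]) auto
  next
    case (Suc j)
    then obtain X' where X': "X' \<subseteq> X" "card X' \<le> j" "j * q \<le> 2 * card (case_prod f ` (X' \<times> Y))"
      by auto
    define Z where "Z = case_prod f ` (X' \<times> Y)"
    have finX': "finite X'" using X' X finite_subset by blast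
    then have finZ: "finite Z" using Y by (simp add: Z_def)
    have "card Z \<le> card (X' \<times> Y)" unfolding Z_def using finX' Y by (intro card_image_le) auto
    also have "\<dots> \<le> j * q" using X'(2) Y by (simp add: card_cartesian_product)
    finally have cZ: "card Z \<le> j * q" .
    \<comment> \<open>If every \<open>x\<close> had more than half of its values in
      \<open>Z\<close>, there would be more than \<open>card X * q / 2\<close> pairs with value in
      \<open>Z\<close>; but for each \<open>y\<close> there are at most \<open>card Z\<close> of
      them by injectivity.\<close>
    have "\<exists>x\<in>X. 2 * card {y\<in>Y. f x y \<in> Z} \<le> q"
    proof (rule ccontr)
      assume "\<not> ?thesis"
      then have big: "\<And>x. x \<in> X \<Longrightarrow> Suc q \<le> 2 * card {y\<in>Y. f x y \<in> Z}" by force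
      have "card X * Suc q \<le> (\<Sum>x\<in>X. 2 * card {y\<in>Y. f x y \<in> Z})"
        using sum_bounded_below[OF big] by simp
      also have "\<dots> = 2 * (\<Sum>x\<in>X. \<Sum>y\<in>Y. if f x y \<in> Z then 1 else 0)"
        using Y by (simp add: sum_distrib_left sum.If_cases Int_def)
      also have "\<dots> = 2 * (\<Sum>y\<in>Y. \<Sum>x\<in>X. if f x y \<in> Z then 1 else 0)"
        by (subst sum.swap) simp
      also have "\<dots> = 2 * (\<Sum>y\<in>Y. card {x\<in>X. f x y \<in> Z})"
        using X by (simp add: sum.If_cases Int_def)
      also have "\<dots> \<le> 2 * (\<Sum>y\<in>Y. card Z)"
      proof (intro mult_left_mono sum_mono)
        fix y assume y: "y \<in> Y"
        show "card {x\<in>X. f x y \<in> Z} \<le> card Z"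
          using inj1[OF y] finZ by (intro card_inj_on_le[of "\<lambda>x. f x y"]) (auto simp: inj_on_def)
      qed simp
      also have "\<dots> = 2 * q * card Z" using Y by simp
      also have "\<dots> \<le> 2 * q * (q * q)"
        using cZ Suc.prems by (intro mult_left_mono) (meson Suc_leD le_trans mult_le_mono1, simp)
      also have "\<dots> \<le> card X * q" using X(2) by (simp add: power2_eq_square mult.assoc mult.commute)
      finally have "card X = 0" by simp
      then show False using X(2) Suc.prems by simp
    qed
    then obtain x where x: "x \<in> X" "2 * card {y\<in>Y. f x y \<in> Z} \<le> q" by blast
    define N where "N = f x ` {y\<in>Y. f x y \<notin> Z}"
    have "card N = card {y\<in>Y. f x y \<notin> Z}" unfolding N_def
      using inj2[OF x(1)] by (intro card_image) (auto simp: inj_on_def)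
    moreover have "card {y\<in>Y. f x y \<in> Z} + card {y\<in>Y. f x y \<notin> Z} = q"
      using Y by (subst card_Un_disjoint[symmetric]) (auto intro: arg_cong[where f=card])
    ultimately have cN: "q \<le> 2 * card N" using x(2) by linarith
    have eq: "case_prod f ` (insert x X' \<times> Y) = Z \<union> N" unfolding Z_def N_def by auto
    have "card (Z \<union> N) = card Z + card N"
      using finZ Y by (intro card_Un_disjoint) (auto simp: N_def)
    then have "Suc j * q \<le> 2 * card (case_prod f ` (insert x X' \<times> Y))"
      using cN X'(3) unfolding eq Z_def[symmetric] by simp
    moreover have "card (insert x X') \<le> Suc j" using X'(2) finX' by (simp add: card_insert_if)
    ultimately show ?case using x(1) X'(1) by (intro exI[of _ "insert x X'"]) auto
  qed
  from this[of q] show ?thesis by (simp add: power2_eq_square)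
qed

text \<open>Mirsky's argument: more than \<open>s\<close> minimal elements form an antichain;
  otherwise they are deleted, and a chain found in the rest has an element of \<open>P\<close> below
  its least one, which prolongs it. The measure \<open>\<mu>\<close> makes \<open>R\<close>
  irreflexive and provides the least element of a chain.\<close>

lemma chain_or_antichain:
  fixes R :: "'a \<Rightarrow> 'a \<Rightarrow> bool" and \<mu> :: "'a \<Rightarrow> nat"
  assumes "transp R" and mono: "\<And>x y. R x y \<Longrightarrow> \<mu> x < \<mu> y"
  assumes "finite P" "r * s < card P"
  shows "\<exists>C\<subseteq>P. (r < card C \<and> (\<forall>x\<in>C. \<forall>y\<in>C. x \<noteq> y \<longrightarrow> R x y \<or> R y x))
           \<or> (s < card C \<and> (\<forall>x\<in>C. \<forall>y\<in>C. \<not> R x y))"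
  using assms(3,4)
proof (induction r arbitrary: P)
  case 0
  then obtain x where "x \<in> P" by fastforce
  then show ?case by (intro exI[of _ "{x}"]) auto
next
  case (Suc r)
  define M where "M = {x\<in>P. \<forall>y\<in>P. \<not> R y x}"
  show ?case
  proof (cases "s < card M")
    case True
    then show ?thesis by (intro exI[of _ M]) (auto simp: M_def)
  next
    case False
    have "card (P - M) = card P - card M"
      using Suc.prems by (intro card_Diff_subset) (auto simp: M_def)
    then have "r * s < card (P - M)" using Suc.prems False by simp
    then obtain C where C: "C \<subseteq> P - M" "(r < card C \<and> (\<forall>x\<in>C. \<forall>y\<in>C. x \<noteq> y \<longrightarrow> R x y \<or> R y x))
           \<or> (s < card C \<and> (\<forall>x\<in>C. \<forall>y\<in>C. \<not> R x y))"
      using Suc.IH[of "P - M"] Suc.prems by auto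
    show ?thesis
    proof (cases "s < card C \<and> (\<forall>x\<in>C. \<forall>y\<in>C. \<not> R x y)")
      case True
      then show ?thesis using C by (intro exI[of _ C]) auto
    next
      case False
      then have chain: "r < card C" "\<forall>x\<in>C. \<forall>y\<in>C. x \<noteq> y \<longrightarrow> R x y \<or> R y x" using C(2) by blast+
      have fin: "finite C" using C Suc.prems by (meson finite_Diff finite_subset)
      obtain x where x: "x \<in> C" "\<forall>y\<in>C. \<mu> x \<le> \<mu> y"
        using fin chain(1) by (metis arg_min_least arg_min_if_finite(1) card.empty not_less_zero)
      obtain y where y: "y \<in> P" "R y x" using x(1) C(1) by (auto simp: M_def)
      have below: "\<forall>z\<in>C. R y z"
        using chain(2) x y(2) mono \<open>transp R\<close> by (metis leD transpD)
      then have "y \<notin> C" using mono by (metis less_irrefl)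
      then have "Suc r < card (insert y C)" using chain(1) fin by simp
      moreover have "\<forall>a\<in>insert y C. \<forall>b\<in>insert y C. a \<noteq> b \<longrightarrow> R a b \<or> R b a"
        using below chain(2) by auto
      ultimately show ?thesis using y(1) C(1) by (intro exI[of _ "insert y C"]) auto
    qed
  qed
qed

section \<open>Dyadic pigeonholing\<close>

lemma le_sum_powers_of_two:
  fixes t :: nat
  assumes "t < 2 ^ H"
  shows "t \<le> (\<Sum>h<H. if 2 ^ h \<le> t then 2 ^ h else 0)"
  using assms
proof (induction H arbitrary: t)
  case (Suc H)
  have geo: "(\<Sum>h<H. (2::nat) ^ h) = 2 ^ H - 1" by (induction H) auto
  show ?case
  proof (cases "t < 2 ^ H")
    case True
    then show ?thesis using Suc.IH[of t] by simp
  next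
    case False
    then have "2 ^ h \<le> t" if "h < H" for h
      using that by (meson le_trans less_imp_le_nat not_less one_le_numeral power_increasing)
    then have "(\<Sum>h<H. if 2 ^ h \<le> t then 2 ^ h else 0) = (\<Sum>h<H. (2::nat) ^ h)"
      by (intro sum.cong) auto
    then show ?thesis using False Suc.prems geo by auto
  qed
qed simp

text \<open>Every \<open>t i\<close> is at most the sum of the powers of two up to
  \<open>t i\<close>. Summing over \<open>i\<close> first splits the total into \<open>H\<close>
  levels, and one of them carries a fraction \<open>1 / H\<close>.\<close>

lemma dyadic_level_pigeonhole:
  fixes t :: "'a \<Rightarrow> nat"
  assumes "finite I" "\<And>i. i \<in> I \<Longrightarrow> t i < 2 ^ H" "0 < H"
  shows "\<exists>h<H. sum t I \<le> H * (2 ^ h * card {i\<in>I. 2 ^ h \<le> t i})"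
proof (rule ccontr)
  assume "\<not> ?thesis"
  then have *: "H * (2 ^ h * card {i\<in>I. 2 ^ h \<le> t i}) < sum t I" if "h < H" for h
    using that by auto
  have "sum t I \<le> (\<Sum>i\<in>I. \<Sum>h<H. if 2 ^ h \<le> t i then 2 ^ h else 0)"
    using assms by (intro sum_mono le_sum_powers_of_two) auto
  also have "\<dots> = (\<Sum>h<H. \<Sum>i\<in>I. if 2 ^ h \<le> t i then 2 ^ h else 0)" by (rule sum.swap)
  also have "\<dots> = (\<Sum>h<H. 2 ^ h * card {i\<in>I. 2 ^ h \<le> t i})"
    using assms(1) by (simp add: sum.If_cases Int_def mult.commute)
  finally have "H * sum t I \<le> (\<Sum>h<H. H * (2 ^ h * card {i\<in>I. 2 ^ h \<le> t i}))"
    by (simp add: sum_distrib_left[symmetric])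
  also have "\<dots> < (\<Sum>h<H. sum t I)"
    using * assms(3) by (intro sum_strict_mono) auto
  finally show False by simp
qed

text \<open>The translates of \<open>A\<close> by \<open>Min B\<close> and of \<open>B\<close> by
  \<open>Max A\<close> both lie in the sumset and meet in at most one point.\<close>

lemma card_sumset_ge:
  fixes A B :: "nat set"
  assumes "finite A" "finite B" "A \<noteq> {}" "B \<noteq> {}"
  shows "card A + card B \<le> Suc (card {a + b | a b. a \<in> A \<and> b \<in> B})"
proof -
  have fin: "finite {a + b | a b. a \<in> A \<and> b \<in> B}"
    using assms(1,2) by (simp add: finite_image_set2)
  let ?U = "(\<lambda>a. a + Min B) ` A" and ?V = "(\<lambda>b. Max A + b) ` B"
  have "?U \<inter> ?V \<subseteq> {Max A + Min B}"
  proof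
    fix z assume "z \<in> ?U \<inter> ?V"
    then obtain a b where "z = a + Min B" "a \<in> A" "z = Max A + b" "b \<in> B" by blast
    moreover have "a \<le> Max A" "Min B \<le> b" using calculation assms by auto
    ultimately show "z \<in> {Max A + Min B}" by simp
  qed
  then have "card (?U \<inter> ?V) \<le> 1" by (metis card.empty card_insert_if card_mono finite.emptyI finite_insert is_singletonI is_singleton_altdef)
  moreover have "card ?U = card A" "card ?V = card B" by (auto intro!: card_image simp: inj_on_def)
  moreover have "card ?U + card ?V = card (?U \<union> ?V) + card (?U \<inter> ?V)"
    using assms by (intro card_Un_Int) auto
  moreover have "card (?U \<union> ?V) \<le> card {a + b | a b. a \<in> A \<and> b \<in> B}"
    using Min_in[of B] Max_in[of A] assms by (intro card_mono fin) blast+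
  ultimately show ?thesis by linarith
qed

section \<open>Sumsets of several sets\<close>

definition sums_of :: "nat \<Rightarrow> (nat \<Rightarrow> nat set) \<Rightarrow> nat set" where
  "sums_of g B = {\<Sum>i<g. f i | f. \<forall>i<g. f i \<in> B i}"

lemma sums_of_0: "sums_of 0 B = {0}"
  by (simp add: sums_of_def)

lemma sums_of_Suc: "sums_of (Suc g) B = {s + b | s b. s \<in> sums_of g B \<and> b \<in> B g}"
proof (intro equalityI subsetI)
  fix z assume "z \<in> sums_of (Suc g) B"
  then obtain f where f: "\<forall>i<Suc g. f i \<in> B i" "z = (\<Sum>i<g. f i) + f g" by (auto simp: sums_of_def)
  moreover have "(\<Sum>i<g. f i) \<in> sums_of g B" using f(1) unfolding sums_of_def by fastforce
  ultimately show "z \<in> {s + b | s b. s \<in> sums_of g B \<and> b \<in> B g}" by blast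
next
  fix z assume "z \<in> {s + b | s b. s \<in> sums_of g B \<and> b \<in> B g}"
  then obtain f b where f: "z = (\<Sum>i<g. f i) + b" "\<forall>i<g. f i \<in> B i" "b \<in> B g"
    by (auto simp: sums_of_def)
  have "(\<Sum>i<Suc g. (f(g := b)) i) = z" using f(1) by simp
  moreover have "\<forall>i<Suc g. (f(g := b)) i \<in> B i" using f(2,3) by (auto simp: less_Suc_eq)
  ultimately show "z \<in> sums_of (Suc g) B" unfolding sums_of_def by blast
qed

text \<open>By \<open>card_sumset_ge\<close>, each further set with more than \<open>k\<close>
  elements enlarges the sumset by at least \<open>k\<close>.\<close>

lemma card_sums_of_ge:
  assumes "\<And>i. i < g \<Longrightarrow> finite (B i) \<and> k < card (B i)"
  shows "finite (sums_of g B) \<and> g * k < card (sums_of g B)"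
  using assms
proof (induction g)
  case 0
  then show ?case by (simp add: sums_of_0)
next
  case (Suc g)
  then have IH: "finite (sums_of g B)" "g * k < card (sums_of g B)" and B: "finite (B g)" "k < card (B g)"
    by auto
  have "sums_of g B \<noteq> {}" "B g \<noteq> {}" using IH(2) B(2) by auto
  from card_sumset_ge[OF IH(1) B(1) this] have "Suc g * k < card (sums_of (Suc g) B)"
    using IH(2) B(2) unfolding sums_of_Suc by simp
  moreover have "finite (sums_of (Suc g) B)" unfolding sums_of_Suc using IH B by (simp add: finite_image_set2)
  ultimately show ?case by blast
qed

section \<open>Counting sets by short descriptions\<close>

lemma card_bounded_subsets:
  assumes "finite A"
  shows "finite {X. X \<subseteq> A \<and> card X \<le> t} \<and> card {X. X \<subseteq> A \<and> card X \<le> t} \<le> Suc (card A) ^ t"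
proof -
  let ?L = "{xs. set xs \<subseteq> insert None (Some ` A) \<and> length xs = t}"
  have fin: "finite ?L" using assms by (intro finite_lists_length_eq) auto
  have "{X. X \<subseteq> A \<and> card X \<le> t} \<subseteq> (\<lambda>xs. {a. Some a \<in> set xs}) ` ?L"
  proof
    fix X assume "X \<in> {X. X \<subseteq> A \<and> card X \<le> t}"
    then have X: "X \<subseteq> A" "card X \<le> t" by auto
    obtain ys where ys: "set ys = X" "length ys = card X"
      using finite_distinct_list[of X] X(1) assms by (metis distinct_card finite_subset)
    \<comment> \<open>A set is read off a list of length exactly \<open>t\<close>; the entry
      \<open>None\<close> pads the lists of smaller sets, whence the base
      \<open>Suc (card A)\<close>.\<close>
    let ?xs = "map Some ys @ replicate (t - card X) None"
    have in_L: "?xs \<in> ?L" using X ys by auto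
    have "X = {a. Some a \<in> set ?xs}" using ys by auto
    then show "X \<in> (\<lambda>xs. {a. Some a \<in> set xs}) ` ?L" using in_L by (rule image_eqI)
  qed
  then have "finite {X. X \<subseteq> A \<and> card X \<le> t}" "card {X. X \<subseteq> A \<and> card X \<le> t} \<le> card ?L"
    using fin by (auto intro: finite_surj surj_card_le)
  moreover have "card ?L = Suc (card A) ^ t"
    using assms by (subst card_lists_length_eq) (auto simp: card_image)
  ultimately show ?thesis by simp
qed

text \<open>A set \<open>S\<close> above a core \<open>B\<close> is determined by \<open>B\<close>
  and \<open>S - B\<close>. So a core with \<open>g\<close> elements saves \<open>g\<close> bits,
  minus the bits needed to name it.\<close>

lemma card_supersets_le:
  assumes "finite U" "\<S> \<subseteq> Pow U" "finite \<B>"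
    and "\<And>S. S \<in> \<S> \<Longrightarrow> \<exists>B\<in>\<B>. B \<subseteq> S \<and> g \<le> card B"
  shows "card \<S> * 2 ^ g \<le> card \<B> * 2 ^ card U"
proof -
  let ?B = "{B\<in>\<B>. B \<subseteq> U \<and> g \<le> card B}"
  have one: "card {S. B \<subseteq> S \<and> S \<subseteq> U} * 2 ^ g \<le> 2 ^ card U" if "B \<in> ?B" for B
  proof -
    have B: "B \<subseteq> U" "finite B" "g \<le> card B" using that assms(1) finite_subset by auto
    have "{S. B \<subseteq> S \<and> S \<subseteq> U} \<subseteq> (\<lambda>T. B \<union> T) ` Pow (U - B)"
    proof
      fix S assume "S \<in> {S. B \<subseteq> S \<and> S \<subseteq> U}"
      then have "S = B \<union> (S - B)" "S - B \<in> Pow (U - B)" by auto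
      then show "S \<in> (\<lambda>T. B \<union> T) ` Pow (U - B)" by blast
    qed
    then have "card {S. B \<subseteq> S \<and> S \<subseteq> U} \<le> card (Pow (U - B))"
      using assms(1) by (intro surj_card_le) auto
    also have "\<dots> = 2 ^ (card U - card B)" using B assms(1) by (simp add: card_Pow card_Diff_subset)
    finally have "card {S. B \<subseteq> S \<and> S \<subseteq> U} * 2 ^ g \<le> 2 ^ (card U - card B) * 2 ^ card B"
      using B(3) by (intro mult_le_mono) (auto intro: power_increasing)
    also have "\<dots> = 2 ^ card U" using B assms(1) by (simp add: power_add[symmetric] card_mono)
    finally show ?thesis .
  qed
  have "\<S> \<subseteq> (\<Union>B\<in>?B. {S. B \<subseteq> S \<and> S \<subseteq> U})" using assms(2,4) by fastforce
  then have "card \<S> \<le> card (\<Union>B\<in>?B. {S. B \<subseteq> S \<and> S \<subseteq> U})"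
    using assms(1,3) by (intro card_mono finite_UN_I) auto
  also have "\<dots> \<le> (\<Sum>B\<in>?B. card {S. B \<subseteq> S \<and> S \<subseteq> U})"
    using assms(3) by (intro card_UN_le) auto
  finally have "card \<S> * 2 ^ g \<le> (\<Sum>B\<in>?B. card {S. B \<subseteq> S \<and> S \<subseteq> U} * 2 ^ g)"
    by (simp add: sum_distrib_right[symmetric])
  also have "\<dots> \<le> (\<Sum>B\<in>?B. 2 ^ card U)" by (intro sum_mono one)
  also have "\<dots> \<le> card \<B> * 2 ^ card U" using assms(3) by (simp add: card_mono)
  finally show ?thesis .
qed

section \<open>Cycles made of a long cycle and its chords\<close>

text \<open>Cycles are vertex lists over an arbitrary relation, so that they can be written down as
  concatenated intervals; \<open>cycle_set_eq_cyc_lens\<close> gives the link to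
  \<open>cycle_set\<close>.\<close>

definition cyc_lens :: "('a \<Rightarrow> 'a \<Rightarrow> bool) \<Rightarrow> nat set" where
  "cyc_lens E = {length vs | vs. 3 \<le> length vs \<and> distinct vs \<and> successively E vs \<and> E (last vs) (hd vs)}"

lemma cyc_lensI:
  assumes "distinct vs" "successively E vs" "E (last vs) (hd vs)" "3 \<le> length vs" "length vs = m"
  shows "m \<in> cyc_lens E"
  using assms unfolding cyc_lens_def by blast

text \<open>This is \<open>chain_or_antichain\<close> for strict inclusion of intervals with
  \<open>r = s = m - 1\<close>: incomparable intervals have both pairs of end points in the same
  order. They cross only if they share a point, which is ensured where the lemma is applied.\<close>

lemma nested_or_crossing:
  fixes P :: "(nat \<times> nat) set"
  assumes "finite P" "m * m \<le> card P" "1 \<le> m" and increasing: "\<And>x. x \<in> P \<Longrightarrow> fst x < snd x"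
  shows "\<exists>C\<subseteq>P. m \<le> card C \<and>
    ((\<forall>x\<in>C. \<forall>y\<in>C. x \<noteq> y \<longrightarrow> (fst x \<le> fst y \<and> snd y \<le> snd x) \<or> (fst y \<le> fst x \<and> snd x \<le> snd y)) \<or>
     (\<forall>x\<in>C. \<forall>y\<in>C. x \<noteq> y \<longrightarrow> (fst x < fst y \<and> snd x < snd y) \<or> (fst y < fst x \<and> snd y < snd x)))"
proof -
  \<comment> \<open>The two conditions \<open>fst x < snd x\<close> and \<open>fst y < snd y\<close>
    make the truncated difference \<open>snd x - fst x\<close> strictly monotone for all pairs, also
    outside \<open>P\<close>.\<close>
  define R :: "nat \<times> nat \<Rightarrow> nat \<times> nat \<Rightarrow> bool" where
    "R x y \<longleftrightarrow> fst x < snd x \<and> fst y < snd y \<and> x \<noteq> y \<and> fst y \<le> fst x \<and> snd x \<le> snd y" for x y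
  have "transp R" by (auto simp: transp_def R_def prod_eq_iff)
  moreover have "snd x - fst x < snd y - fst y" if "R x y" for x y
    using that by (auto simp: R_def prod_eq_iff)
  moreover have "(m - 1) * (m - 1) < card P"
    using assms(2,3) by (cases m) auto
  ultimately obtain C where C: "C \<subseteq> P"
    "(m - 1 < card C \<and> (\<forall>x\<in>C. \<forall>y\<in>C. x \<noteq> y \<longrightarrow> R x y \<or> R y x)) \<or> (m - 1 < card C \<and> (\<forall>x\<in>C. \<forall>y\<in>C. \<not> R x y))"
    using chain_or_antichain[of R "\<lambda>x. snd x - fst x" P "m - 1" "m - 1"] assms(1) by blast
  have lt: "fst x < snd x" if "x \<in> C" for x using that C(1) increasing by blast
  from C(2) show ?thesis
  proof
    assume "m - 1 < card C \<and> (\<forall>x\<in>C. \<forall>y\<in>C. x \<noteq> y \<longrightarrow> R x y \<or> R y x)"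
    then show ?thesis using C(1) by (intro exI[of _ C]) (auto simp: R_def)
  next
    assume *: "m - 1 < card C \<and> (\<forall>x\<in>C. \<forall>y\<in>C. \<not> R x y)"
    have "(fst x < fst y \<and> snd x < snd y) \<or> (fst y < fst x \<and> snd y < snd x)"
      if "x \<in> C" "y \<in> C" "x \<noteq> y" for x y
    proof -
      have "\<not> R x y" "\<not> R y x" using * that by auto
      then show ?thesis using that lt[of x] lt[of y] unfolding R_def by (metis leI linorder_neqE_nat nat_less_le)
    qed
    then show ?thesis using C(1) * by (intro exI[of _ C]) auto
  qed
qed

text \<open>Numbering the vertices along the long cycle turns its arcs into intervals of numbers. By
  \<open>cycle_graph_of_cycle\<close> this is no loss of generality.\<close>

locale cycle_graph =
  fixes n l :: nat and E :: "nat \<Rightarrow> nat \<Rightarrow> bool"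
  assumes sym: "E x y \<Longrightarrow> E y x"
    and irrefl: "\<not> E x x"
    and bounded: "E x y \<Longrightarrow> x < n"
    and length_ge: "3 \<le> l" and length_le: "l \<le> n"
    and step: "Suc i < l \<Longrightarrow> E i (Suc i)"
    and closing: "E (l - 1) 0"
begin

lemma successively_upt: "b \<le> l \<Longrightarrow> successively E [a..<b]"
  unfolding successively_conv_nth by (auto intro: step)

lemma successively_rev_upt: "b \<le> l \<Longrightarrow> successively E (rev [a..<b])"
  using successively_upt[of b a] sym by (auto simp: successively_rev elim: successively_mono)

text \<open>
  \<open>route a b x\<close>: the part \<open>a, \<dots>, b - 1\<close> of the cycle can be replaced by a path with the same end
  points that visits only vertices of this part and misses exactly \<open>x\<close> of them.
\<close>

definition route :: "nat \<Rightarrow> nat \<Rightarrow> nat \<Rightarrow> bool" where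
  "route a b x \<longleftrightarrow> (\<exists>ws. distinct ws \<and> set ws \<subseteq> {a..<b} \<and> successively E ws \<and> length ws + x = b - a
      \<and> (a < b \<longrightarrow> ws \<noteq> [] \<and> hd ws = a \<and> last ws = b - 1))"

lemma route_refl:
  assumes "b \<le> l"
  shows "route a b 0"
  unfolding route_def using successively_upt[OF assms] by (intro exI[of _ "[a..<b]"]) (auto simp: last_upt)

lemma route_trans:
  assumes "route a b x" "route b c y" "a \<le> b" "b \<le> c" "c \<le> l"
  shows "route a c (x + y)"
proof -
  obtain u where u: "distinct u" "set u \<subseteq> {a..<b}" "successively E u" "length u + x = b - a"
    "a < b \<longrightarrow> u \<noteq> [] \<and> hd u = a \<and> last u = b - 1"
    using assms(1) unfolding route_def by blast
  obtain v where v: "distinct v" "set v \<subseteq> {b..<c}" "successively E v" "length v + y = c - b"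
    "b < c \<longrightarrow> v \<noteq> [] \<and> hd v = b \<and> last v = c - 1"
    using assms(2) unfolding route_def by blast
  \<comment> \<open>Two nonempty parts are joined by the cycle edge from \<open>b - 1\<close> to
    \<open>b\<close>. Empty windows have to be allowed, since \<open>cut\<close> is capped at
    \<open>l\<close>.\<close>
  have "E (last u) (hd v)" if "u \<noteq> []" "v \<noteq> []"
  proof -
    have "a < b" "b < c" using that u(2) v(2) by (auto simp: neq_Nil_conv)
    then show ?thesis using u(5) v(5) step[of "b - 1"] assms(5) by simp
  qed
  then have "successively E (u @ v)" using u(3) v(3) by (auto simp: successively_append_iff)
  moreover have "distinct (u @ v)" using u(1,2) v(1,2) by fastforce
  moreover have "set (u @ v) \<subseteq> {a..<c}" using u(2) v(2) assms(3,4) by fastforce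
  moreover have "length (u @ v) + (x + y) = c - a" using u(4) v(4) assms(3,4) by simp
  moreover have "u @ v \<noteq> [] \<and> hd (u @ v) = a \<and> last (u @ v) = c - 1" if "a < c"
  proof -
    have "u = [] \<longleftrightarrow> \<not> a < b" "v = [] \<longleftrightarrow> \<not> b < c" using u(4,5) v(4,5) by auto
    then show ?thesis using u(5) v(5) assms(3,4) that by (cases "a < b"; cases "b < c") auto
  qed
  ultimately show ?thesis unfolding route_def by blast
qed

lemma route_sum:
  assumes "\<And>j. j < J \<Longrightarrow> route (s j) (s (Suc j)) (f j)" "\<And>j. s j \<le> s (Suc j)" "\<And>j. s j \<le> l"
  shows "route 0 (s J) (\<Sum>j<J. f j)"
  using assms(1)
proof (induction J)
  \<comment> \<open>The stretch before \<open>s 0\<close> is traversed unchanged, so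
    \<open>s 0\<close> may be positive.\<close>
  case 0
  then show ?case using route_refl[OF assms(3)] by simp
next
  case (Suc J)
  then show ?case using route_trans[of 0 "s J" _ "s (Suc J)" "f J"] assms(2,3) by simp
qed

lemma route_chord:
  assumes "a \<le> u" "u < v" "v < b" "b \<le> l" "E u v"
  shows "route a b (v - u - 1)"
proof -
  let ?ws = "[a..<Suc u] @ [v..<b]"
  have "successively E ?ws"
    using assms successively_upt[of "Suc u" a] successively_upt[of b v]
    by (auto simp: successively_append_iff simp del: upt_Suc)
  moreover have "last ?ws = b - 1" using assms by (simp add: last_upt)
  moreover have "hd ?ws = a" using assms by (simp add: hd_append del: upt_Suc)
  ultimately show ?thesis unfolding route_def using assms
    by (intro exI[of _ ?ws]) (auto simp del: upt_Suc)
qed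

text \<open>The path runs forward to \<open>u\<close>, jumps to \<open>v\<close>, runs back to
  \<open>u'\<close>, jumps to \<open>v'\<close> and runs on. It misses only the vertices strictly
  between \<open>u\<close> and \<open>u'\<close> and strictly between \<open>v\<close> and
  \<open>v'\<close>.\<close>

lemma route_crossing_chords:
  assumes "a \<le> u" "u < u'" "u' \<le> v" "v < v'" "v' < b" "b \<le> l" "E u v" "E u' v'"
  shows "route a b ((u' - u - 1) + (v' - v - 1))"
proof -
  let ?ws = "[a..<Suc u] @ rev [u'..<Suc v] @ [v'..<b]"
  have "successively E ?ws"
    using assms successively_upt[of "Suc u" a] successively_upt[of b v'] successively_rev_upt[of "Suc v" u']
    by (auto simp: successively_append_iff hd_rev last_rev hd_append simp del: upt_Suc)
  moreover have "last ?ws = b - 1" using assms by (simp add: last_upt)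
  moreover have "hd ?ws = a" using assms by (simp add: hd_append del: upt_Suc)
  ultimately show ?thesis unfolding route_def using assms
    by (intro exI[of _ ?ws]) (auto simp del: upt_Suc)
qed

text \<open>The edge from \<open>l - 1\<close> to \<open>0\<close> closes the path. The case
  \<open>m < 3\<close> does occur: the closing edge, taken as the chord \<open>(0, l - 1)\<close>,
  leaves only its two end points.\<close>

lemma route_imp_cycle:
  assumes "route 0 l x"
  shows "\<exists>m. m + x = l \<and> (3 \<le> m \<longrightarrow> m \<in> cyc_lens E)"
proof -
  obtain ws where "distinct ws" "successively E ws" "length ws + x = l" "hd ws = 0" "last ws = l - 1"
    using assms length_ge unfolding route_def by auto
  then show ?thesis using closing by (auto intro!: cyc_lensI[of ws])
qed

text \<open>The cycle runs from \<open>u\<close> up to \<open>u'\<close>, over the inner chord to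
  \<open>v'\<close>, up to \<open>v\<close> and back over the outer chord; its two arcs have
  \<open>u' - u + 1\<close> and \<open>v - v' + 1\<close> vertices. As the chords differ, these are
  at least three.\<close>

lemma nested_chords_cycle:
  assumes "u \<le> u'" "u' < v'" "v' \<le> v" "v < l" "E u v" "E u' v'" "(u, v) \<noteq> (u', v')"
  shows "(v - u) - (v' - u') + 2 \<in> cyc_lens E"
proof -
  let ?ws = "[u..<Suc u'] @ [v'..<Suc v]"
  have "successively E ?ws"
    using assms successively_upt[of "Suc u'" u] successively_upt[of "Suc v" v']
    by (auto simp: successively_append_iff simp del: upt_Suc)
  moreover have "E (last ?ws) (hd ?ws)" using assms sym by (simp add: hd_append del: upt_Suc)
  ultimately show ?thesis using assms
    by (intro cyc_lensI[of ?ws]) (auto simp del: upt_Suc)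
qed

text \<open>The cycle runs from \<open>u\<close> up to \<open>u'\<close>, over the second chord to
  \<open>v'\<close>, down to \<open>v\<close> and back over the first chord.\<close>

lemma crossing_chords_cycle:
  assumes "u < u'" "u' < v" "v < v'" "v' < l" "E u v" "E u' v'"
  shows "(u' + v') - (u + v) + 2 \<in> cyc_lens E"
proof -
  let ?ws = "[u..<Suc u'] @ rev [v..<Suc v']"
  have "successively E ?ws"
    using assms successively_upt[of "Suc u'" u] successively_rev_upt[of "Suc v'" v]
    by (auto simp: successively_append_iff hd_rev simp del: upt_Suc)
  moreover have "E (last ?ws) (hd ?ws)" using assms sym by (simp add: hd_append last_rev del: upt_Suc)
  ultimately show ?thesis using assms
    by (intro cyc_lensI[of ?ws]) (auto simp del: upt_Suc)
qed

lemma common_neighbour_cycle: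
  assumes "l \<le> w" "u < v" "v < l" "E w u" "E w v"
  shows "v - u + 2 \<in> cyc_lens E"
proof -
  let ?ws = "w # [u..<Suc v]"
  have "successively E ?ws"
    using assms successively_upt[of "Suc v" u] by (auto simp: successively_Cons)
  moreover have "E (last ?ws) (hd ?ws)" using assms sym by simp
  ultimately show ?thesis using assms
    by (intro cyc_lensI[of ?ws]) (auto simp del: upt_Suc)
qed

text \<open>The closing edge is among the chords, as the pair \<open>(0, l - 1)\<close>.\<close>

definition chords :: "(nat \<times> nat) set" where
  "chords = {(u, v). u + 2 \<le> v \<and> v < l \<and> E u v}"

lemma chords_subset: "chords \<subseteq> {..<n} \<times> {..<n}"
  using length_le by (auto simp: chords_def)

lemma finite_chords: "finite chords"
  using finite_subset[OF chords_subset] by simp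

text \<open>The chords from \<open>nested_or_crossing\<close> are labelled by their lengths in the
  nested case and by the sums of their end points otherwise; differences of labels, plus
  \<open>2\<close>, are then the lengths of the cycles made of two chords. Since all chords pass
  over \<open>p\<close>, those that are not nested really cross.\<close>

lemma differences_of_pierced_chords:
  assumes P: "P \<subseteq> chords" "\<And>u v. (u, v) \<in> P \<Longrightarrow> u < p \<and> p \<le> v" and m: "m * m \<le> card P" "1 \<le> m"
  shows "\<exists>A\<subseteq>{..2 * n}. m \<le> card A \<and> (\<forall>x\<in>A. \<forall>y\<in>A. x < y \<longrightarrow> y - x + 2 \<in> cyc_lens E)"
proof -
  have P': "fst x + 2 \<le> snd x" "snd x < l" "E (fst x) (snd x)" "fst x < p" "p \<le> snd x" "snd x < n" if "x \<in> P" for x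
    using that P length_le unfolding chords_def by (force simp: prod_eq_iff)+
  have finP: "finite P" using P(1) finite_chords finite_subset by blast
  have lt: "fst x < snd x" if "x \<in> P" for x using P'(1)[OF that] by simp
  obtain C where C: "C \<subseteq> P" "m \<le> card C"
    "(\<forall>x\<in>C. \<forall>y\<in>C. x \<noteq> y \<longrightarrow> (fst x \<le> fst y \<and> snd y \<le> snd x) \<or> (fst y \<le> fst x \<and> snd x \<le> snd y)) \<or>
     (\<forall>x\<in>C. \<forall>y\<in>C. x \<noteq> y \<longrightarrow> (fst x < fst y \<and> snd x < snd y) \<or> (fst y < fst x \<and> snd y < snd x))"
    using nested_or_crossing[OF finP m lt] by blast
  have CP: "x \<in> P" if "x \<in> C" for x using C(1) that by blast
  from C(3) show ?thesis
  proof
    assume nest: "\<forall>x\<in>C. \<forall>y\<in>C. x \<noteq> y \<longrightarrow> (fst x \<le> fst y \<and> snd y \<le> snd x) \<or> (fst y \<le> fst x \<and> snd x \<le> snd y)"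
    let ?f = "\<lambda>x. snd x - fst x"
    have "inj_on ?f C"
    proof (rule inj_onI)
      fix x y assume xy: "x \<in> C" "y \<in> C" "?f x = ?f y"
      show "x = y"
      proof (rule ccontr)
        assume "x \<noteq> y"
        then have "fst x \<le> fst y \<and> snd y \<le> snd x \<or> fst y \<le> fst x \<and> snd x \<le> snd y"
          using nest xy(1,2) by blast
        then show False
          using \<open>x \<noteq> y\<close> xy(3) P'(1)[OF CP[OF xy(1)]] P'(1)[OF CP[OF xy(2)]]
          by (auto simp: prod_eq_iff)
      qed
    qed
    then have "card (?f ` C) = card C" by (rule card_image)
    moreover have "?f ` C \<subseteq> {..2 * n}" using P'(6)[OF CP] by fastforce
    moreover have "?f y - ?f x + 2 \<in> cyc_lens E" if xy: "x \<in> C" "y \<in> C" "?f x < ?f y" for x y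
    proof -
      have "fst y \<le> fst x \<and> snd x \<le> snd y" using nest xy by fastforce
      then show ?thesis
        using P'[OF CP[OF xy(1)]] P'[OF CP[OF xy(2)]] xy(3)
        by (intro nested_chords_cycle) auto
    qed
    ultimately show ?thesis using C(2) by (intro exI[of _ "?f ` C"]) auto
  next
    assume cross: "\<forall>x\<in>C. \<forall>y\<in>C. x \<noteq> y \<longrightarrow> (fst x < fst y \<and> snd x < snd y) \<or> (fst y < fst x \<and> snd y < snd x)"
    let ?f = "\<lambda>x. fst x + snd x"
    have "inj_on ?f C"
    proof (rule inj_onI)
      fix x y assume xy: "x \<in> C" "y \<in> C" "?f x = ?f y"
      then show "x = y" using cross by fastforce
    qed
    then have "card (?f ` C) = card C" by (rule card_image)
    moreover have "?f ` C \<subseteq> {..2 * n}" using P'(1,6)[OF CP] by fastforce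
    moreover have "?f y - ?f x + 2 \<in> cyc_lens E" if xy: "x \<in> C" "y \<in> C" "?f x < ?f y" for x y
    proof -
      have "fst x < fst y \<and> snd x < snd y" using cross xy by fastforce
      then show ?thesis
        using P'[OF CP[OF xy(1)]] P'[OF CP[OF xy(2)]] by (intro crossing_chords_cycle) auto
    qed
    ultimately show ?thesis using C(2) by (intro exI[of _ "?f ` C"]) auto
  qed
qed

text \<open>Nested chords have different lengths, so each of them alone shortens the cycle by a
  different amount. Crossing chords could all have the same length; they are used in pairs instead,
  each together with the lowest one.\<close>

lemma routes_of_pierced_chords:
  assumes P: "P \<subseteq> chords" "\<And>u v. (u, v) \<in> P \<Longrightarrow> u < p \<and> p \<le> v" and m: "m * m \<le> card P" "1 \<le> m"
    and window: "\<And>u v. (u, v) \<in> P \<Longrightarrow> a \<le> u \<and> v < b" "b \<le> l"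
  shows "\<exists>A\<subseteq>{..n}. m \<le> Suc (card A) \<and> (\<forall>x\<in>A. route a b x)"
proof -
  have P': "fst x + 2 \<le> snd x" "snd x < l" "E (fst x) (snd x)" "fst x < p" "p \<le> snd x" "snd x < n"
    "a \<le> fst x" "snd x < b" if "x \<in> P" for x
    using that P window length_le unfolding chords_def by (force simp: prod_eq_iff)+
  have finP: "finite P" using P(1) finite_chords finite_subset by blast
  have lt: "fst x < snd x" if "x \<in> P" for x using P'(1)[OF that] by simp
  obtain C where C: "C \<subseteq> P" "m \<le> card C"
    "(\<forall>x\<in>C. \<forall>y\<in>C. x \<noteq> y \<longrightarrow> (fst x \<le> fst y \<and> snd y \<le> snd x) \<or> (fst y \<le> fst x \<and> snd x \<le> snd y)) \<or>
     (\<forall>x\<in>C. \<forall>y\<in>C. x \<noteq> y \<longrightarrow> (fst x < fst y \<and> snd x < snd y) \<or> (fst y < fst x \<and> snd y < snd x))"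
    using nested_or_crossing[OF finP m lt] by blast
  have CP: "x \<in> P" if "x \<in> C" for x using C(1) that by blast
  have finC: "finite C" using C(1) finP finite_subset by blast
  from C(3) show ?thesis
  proof
    assume nest: "\<forall>x\<in>C. \<forall>y\<in>C. x \<noteq> y \<longrightarrow> (fst x \<le> fst y \<and> snd y \<le> snd x) \<or> (fst y \<le> fst x \<and> snd x \<le> snd y)"
    let ?f = "\<lambda>x. snd x - fst x - 1"
    have "inj_on ?f C"
    proof (rule inj_onI)
      fix x y assume xy: "x \<in> C" "y \<in> C" "?f x = ?f y"
      show "x = y"
      proof (rule ccontr)
        assume "x \<noteq> y"
        then have "fst x \<le> fst y \<and> snd y \<le> snd x \<or> fst y \<le> fst x \<and> snd x \<le> snd y"
          using nest xy(1,2) by blast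
        then show False
          using \<open>x \<noteq> y\<close> xy(3) P'(1)[OF CP[OF xy(1)]] P'(1)[OF CP[OF xy(2)]]
          by (auto simp: prod_eq_iff)
      qed
    qed
    then have "card (?f ` C) = card C" by (rule card_image)
    moreover have "?f ` C \<subseteq> {..n}" using P'(6)[OF CP] by fastforce
    moreover have "route a b (?f x)" if "x \<in> C" for x
      using P'[OF CP[OF that]] window(2) by (intro route_chord) auto
    ultimately show ?thesis using C(2) by (intro exI[of _ "?f ` C"]) auto
  next
    assume cross: "\<forall>x\<in>C. \<forall>y\<in>C. x \<noteq> y \<longrightarrow> (fst x < fst y \<and> snd x < snd y) \<or> (fst y < fst x \<and> snd y < snd x)"
    have "C \<noteq> {}" using C(2) m(2) by auto
    \<comment> \<open>The lowest chord \<open>z\<close> has no partner below it and is lost, hence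
      the \<open>Suc\<close> in the claim.\<close>
    then obtain z where z: "z \<in> C" "\<And>x. x \<in> C \<Longrightarrow> fst z \<le> fst x"
      using finC by (metis arg_min_least arg_min_if_finite(1))
    have above: "fst z < fst x \<and> snd z < snd x" if "x \<in> C - {z}" for x
      using that cross z by fastforce
    let ?f = "\<lambda>x. (fst x - fst z - 1) + (snd x - snd z - 1)"
    have "inj_on ?f (C - {z})"
    proof (rule inj_onI)
      fix x y assume xy: "x \<in> C - {z}" "y \<in> C - {z}" "?f x = ?f y"
      then have "fst x + snd x = fst y + snd y" using above[of x] above[of y] by auto
      then show "x = y" using cross xy by fastforce
    qed
    then have "card (?f ` (C - {z})) = card (C - {z})" by (rule card_image)
    moreover have "?f ` (C - {z}) \<subseteq> {..n}"
    proof
      fix k assume "k \<in> ?f ` (C - {z})"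
      then obtain x where x: "x \<in> C - {z}" "k = ?f x" by blast
      then show "k \<in> {..n}" using above[of x] P'[of z] P'[of x] CP z(1) by auto
    qed
    moreover have "route a b (?f x)" if "x \<in> C - {z}" for x
      using P'[of x] P'[of z] CP that z(1) above[OF that] window(2)
      by (intro route_crossing_chords) auto
    moreover have "card C = Suc (card (C - {z}))" using z(1) finC by (metis card_Suc_Diff1)
    ultimately show ?thesis using C(2) by (intro exI[of _ "?f ` (C - {z})"]) auto
  qed
qed

end

section \<open>Three ways for a set to have many elements with a short description\<close>

definition diff_rich :: "nat \<Rightarrow> nat \<Rightarrow> nat set \<Rightarrow> bool" where
  "diff_rich q n S \<longleftrightarrow>
    (\<exists>A\<subseteq>{..2 * n}. 3 * q\<^sup>2 \<le> card A \<and> (\<forall>x\<in>A. \<forall>y\<in>A. x < y \<longrightarrow> y - x + 2 \<in> S))"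

text \<open>The set \<open>A i\<close> stands for the numbers of vertices that can be saved in the
  \<open>i\<close>-th window. Windows are used in pairs, hence \<open>2 * g\<close>, and
  \<open>2 * q\<^sup>2\<close> is the size needed for \<open>sumset_of_few_elements\<close>. The
  equation for \<open>m\<close> avoids truncated subtraction.\<close>

definition sum_rich :: "nat \<Rightarrow> nat \<Rightarrow> nat \<Rightarrow> nat set \<Rightarrow> bool" where
  "sum_rich g q n S \<longleftrightarrow>
    (\<exists>l\<le>n. \<exists>A. (\<forall>i<2 * g. A i \<subseteq> {..n} \<and> 2 * q\<^sup>2 \<le> card (A i)) \<and>
      (\<forall>f. (\<forall>i<2 * g. f i \<in> A i) \<longrightarrow> (\<exists>m. m + (\<Sum>i<2 * g. f i) = l \<and> (3 \<le> m \<longrightarrow> m \<in> S))))"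

text \<open>The progression comes from \<open>J\<close> disjoint chords, each of which saves
  \<open>x\<close> vertices.\<close>

definition prog_rich :: "nat \<Rightarrow> nat \<Rightarrow> nat set \<Rightarrow> bool" where
  "prog_rich J n S \<longleftrightarrow>
    (\<exists>l\<le>n. \<exists>x. 1 \<le> x \<and> x \<le> n \<and> (\<forall>j\<le>J. \<exists>m. m + j * x = l \<and> (3 \<le> m \<longrightarrow> m \<in> S)))"

section \<open>Groups of chords in disjoint windows\<close>

context cycle_graph
begin

text \<open>
  All chords of a group pass over the point \<open>w * (3 * j + \<rho> + 1)\<close>, and for fixed \<open>w\<close> and \<open>\<rho>\<close>
  the groups occupy disjoint windows.
\<close>

definition group :: "nat \<Rightarrow> nat \<Rightarrow> nat \<Rightarrow> (nat \<times> nat) set" where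
  "group w \<rho> j = {(u, v) \<in> chords. w \<le> v - u \<and> v - u < 2 * w \<and> u div w = 3 * j + \<rho>}"

text \<open>A window consists of three blocks of length \<open>w\<close>: a chord of the group
  starts in the first one and is shorter than \<open>2 * w\<close>, so it ends before the third one
  is over. The cap keeps all windows inside the cycle.\<close>

definition cut :: "nat \<Rightarrow> nat \<Rightarrow> nat \<Rightarrow> nat" where
  "cut w \<rho> j = min l (w * (3 * j + \<rho>))"

lemma cut_mono: "cut w \<rho> j \<le> cut w \<rho> (Suc j)"
  unfolding cut_def by (simp add: min.coboundedI2)

lemma cut_le: "cut w \<rho> j \<le> l"
  by (simp add: cut_def)

lemma group_subset: "group w \<rho> j \<subseteq> chords"
  by (auto simp: group_def)

lemma group_pierced:
  assumes "(u, v) \<in> group w \<rho> j" "0 < w"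
  shows "u < w * (3 * j + \<rho> + 1)" "w * (3 * j + \<rho> + 1) \<le> v"
    "cut w \<rho> j \<le> u" "v < cut w \<rho> (Suc j)"
proof -
  have uv: "u + w \<le> v" "v < u + 2 * w" "v < l" "u div w = 3 * j + \<rho>"
    using assms by (auto simp: group_def chords_def)
  have "w * (u div w) \<le> u" by simp
  then have lo: "w * (3 * j + \<rho>) \<le> u" using uv(4) by simp
  have "u < w * Suc (u div w)" using assms(2) by (rule dividend_less_times_div[THEN order_less_le_trans]) simp
  then have hi: "u < w * (3 * j + \<rho>) + w" using uv(4) by simp
  show "u < w * (3 * j + \<rho> + 1)" using hi by (simp add: algebra_simps)
  show "w * (3 * j + \<rho> + 1) \<le> v" using lo uv(1) by (simp add: algebra_simps)
  show "cut w \<rho> j \<le> u" using lo by (simp add: cut_def)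
  have "v < w * (3 * j + \<rho>) + 3 * w" using hi uv(2) by simp
  then show "v < cut w \<rho> (Suc j)" using uv(3) by (simp add: cut_def algebra_simps)
qed

lemma group_nonempty:
  assumes "group w \<rho> j \<noteq> {}" "0 < w"
  shows "j < l" "w * j < n"
proof -
  obtain u v where uv: "(u, v) \<in> group w \<rho> j" using assms by auto
  have "v < l" using uv by (auto simp: group_def chords_def)
  then have "w * (3 * j + \<rho> + 1) < l" using group_pierced(2)[OF uv assms(2)] by simp
  moreover have "w * j \<le> w * (3 * j + \<rho> + 1)" by (intro mult_le_mono2) simp
  moreover have "j \<le> w * j" using assms(2) by simp
  ultimately show "j < l" "w * j < n" using length_le by linarith+
qed

lemma routes_in_windows:
  assumes w: "0 < w" and e: "inj_on e {..<k}" "e ` {..<k} \<subseteq> {..<l}"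
    and r: "\<And>i. i < k \<Longrightarrow> route (cut w \<rho> (e i)) (cut w \<rho> (Suc (e i))) (f i)"
  shows "\<exists>m. m + (\<Sum>i<k. f i) = l \<and> (3 \<le> m \<longrightarrow> m \<in> cyc_lens E)"
proof -
  \<comment> \<open>Windows that \<open>e\<close> does not list are traversed unchanged, so they
    save \<open>0\<close> vertices.\<close>
  define f' where "f' j = (if j \<in> e ` {..<k} then f (the_inv_into {..<k} e j) else 0)" for j
  have f'_e: "f' (e i) = f i" if "i < k" for i
    using that e(1) by (simp add: f'_def the_inv_into_f_f)
  have "route (cut w \<rho> j) (cut w \<rho> (Suc j)) (f' j)" if "j < l" for j
  proof (cases "j \<in> e ` {..<k}")
    case True
    then show ?thesis using r f'_e by auto
  next
    case False
    then show ?thesis using route_refl[OF cut_le] by (simp add: f'_def)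
  qed
  then have "route 0 (cut w \<rho> l) (\<Sum>j<l. f' j)"
    by (intro route_sum cut_mono cut_le)
  \<comment> \<open>As \<open>w\<close> is positive, \<open>l\<close> windows reach the end of the
    cycle.\<close>
  moreover have "1 * l \<le> w * (3 * l + \<rho>)" using w by (intro mult_le_mono) auto
  then have "cut w \<rho> l = l" by (simp add: cut_def)
  moreover have "(\<Sum>j<l. f' j) = (\<Sum>j\<in>e ` {..<k}. f' j)"
    using e(2) by (intro sum.mono_neutral_right) (auto simp: f'_def)
  moreover have "\<dots> = (\<Sum>i<k. f i)"
    using e(1) f'_e by (simp add: sum.reindex)
  ultimately show ?thesis using route_imp_cycle by simp
qed

text \<open>Chords are classified by the binary logarithm of their length and by the residue modulo
  \<open>3\<close> of the block in which they start, so some class has a fraction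
  \<open>1 / (3 * L)\<close> of them. The groups of this class have fewer than
  \<open>2 ^ (2 * L)\<close> chords, so \<open>dyadic_level_pigeonhole\<close> loses another factor
  \<open>2 * L\<close>.\<close>

lemma chords_groups:
  assumes "n < 2 ^ L" "0 < L"
  shows "\<exists>w>0. \<exists>\<rho> h. card chords \<le> 6 * L\<^sup>2 * (2 ^ h * card {j\<in>{..<l}. 2 ^ h \<le> card (group w \<rho> j)})"
proof -
  define cls where "cls x = (let w = 2 ^ floor_log (snd x - fst x) in (floor_log (snd x - fst x), (fst x div w) mod 3))"
    for x :: "nat \<times> nat"
  have "floor_log (v - u) < L" if "(u, v) \<in> chords" for u v
  proof -
    have "0 < v - u" "v - u < 2 ^ L" using that assms length_le by (auto simp: chords_def)
    then show ?thesis
      by (meson floor_log_exp2_le le_less_trans nat_power_less_imp_less zero_less_numeral)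
  qed
  then have "cls \<in> chords \<rightarrow> {..<L} \<times> {..<3}" by (auto simp: cls_def Let_def)
  then obtain y where y: "card chords \<le> card (cls -` {y} \<inter> chords) * card ({..<L} \<times> {..<3::nat})"
    using pigeonhole_card[of cls chords "{..<L} \<times> {..<3}"] finite_chords assms(2)
    by (auto simp: lessThan_empty_iff)
  obtain k \<rho> where k: "y = (k, \<rho>)" by fastforce
  define w :: nat where "w = 2 ^ k"
  have "cls -` {y} \<inter> chords \<subseteq> (\<Union>j<l. group w \<rho> j)"
  proof
    fix x assume x: "x \<in> cls -` {y} \<inter> chords"
    obtain u v where uv: "x = (u, v)" by fastforce
    have c: "(u, v) \<in> chords" "floor_log (v - u) = k" "(u div w) mod 3 = \<rho>"
      using x uv k by (auto simp: cls_def w_def Let_def)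
    then have "0 < v - u" by (auto simp: chords_def)
    then have "w \<le> v - u" "v - u < 2 * w"
      using floor_log_exp2_le[of "v - u"] floor_log_exp2_gt[of "v - u"] c(2) by (auto simp: w_def)
    moreover have "u div w = 3 * (u div w div 3) + \<rho>" using c(3) by (metis mult_div_mod_eq)
    ultimately have "x \<in> group w \<rho> (u div w div 3)" using c(1) uv by (simp add: group_def)
    moreover from this have "u div w div 3 < l" using group_nonempty(1)[of w \<rho>] by (force simp: w_def)
    ultimately show "x \<in> (\<Union>j<l. group w \<rho> j)" by blast
  qed
  moreover have fin: "finite (group w \<rho> j)" for j
    by (rule finite_subset[OF group_subset finite_chords])
  ultimately have "card (cls -` {y} \<inter> chords) \<le> card (\<Union>j<l. group w \<rho> j)"
    by (intro card_mono) auto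
  also have "\<dots> \<le> (\<Sum>j<l. card (group w \<rho> j))" by (rule card_UN_le) simp
  finally have 1: "card (cls -` {y} \<inter> chords) \<le> (\<Sum>j<l. card (group w \<rho> j))" .
  have "card (group w \<rho> j) < 2 ^ (2 * L)" for j
  proof -
    have "card (group w \<rho> j) \<le> card ({..<n} \<times> {..<n})"
      using group_subset chords_subset by (intro card_mono) blast+
    also have "\<dots> = n * n" by simp
    also have "\<dots> < 2 ^ L * 2 ^ L" using assms(1) by (intro mult_strict_mono) auto
    finally show ?thesis by (simp add: power_add[symmetric] mult_2)
  qed
  then obtain h where h: "(\<Sum>j<l. card (group w \<rho> j)) \<le> 2 * L * (2 ^ h * card {j\<in>{..<l}. 2 ^ h \<le> card (group w \<rho> j)})"
    using dyadic_level_pigeonhole[of "{..<l}" "\<lambda>j. card (group w \<rho> j)" "2 * L"] assms(2) by auto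
  have "card chords \<le> card (cls -` {y} \<inter> chords) * (3 * L)" using y by simp
  also have "\<dots> \<le> 2 * L * (2 ^ h * card {j\<in>{..<l}. 2 ^ h \<le> card (group w \<rho> j)}) * (3 * L)"
    using 1 h by (intro mult_le_mono1) simp
  finally show ?thesis by (intro exI[of _ w] conjI exI[of _ \<rho>] exI[of _ h]) (auto simp: w_def power2_eq_square algebra_simps)
qed

text \<open>The three claims use the differences in a single group, the routes in all windows, and
  one chord from each group. The hypothesis \<open>9 * q ^ 4 \<le> t\<close> makes room for
  \<open>3 * q\<^sup>2\<close> nested or crossing chords in a group.\<close>

lemma rich_of_groups:
  assumes w: "0 < w" and I: "I = {j\<in>{..<l}. t \<le> card (group w \<rho> j)}" and t: "1 \<le> t"
  shows "1 \<le> card I \<Longrightarrow> 1 \<le> q \<Longrightarrow> 9 * q ^ 4 \<le> t \<Longrightarrow> diff_rich q n (cyc_lens E)"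
    and "1 \<le> q \<Longrightarrow> 9 * q ^ 4 \<le> t \<Longrightarrow> sum_rich (card I div 2) q n (cyc_lens E)"
    and "\<exists>J. card I * (card I - 1) \<le> J * n \<and> prog_rich J n (cyc_lens E)"
proof -
  have finI: "finite I" using I by simp
  have sq: "(3 * q\<^sup>2) * (3 * q\<^sup>2) = 9 * q ^ 4" for q :: nat by (simp add: power2_eq_square power4_eq_xxxx)
  have pq: "1 \<le> 3 * q\<^sup>2" if "1 \<le> q" for q :: nat using that by (simp add: Suc_le_eq)
  show "diff_rich q n (cyc_lens E)" if q: "1 \<le> card I" "1 \<le> q" "9 * q ^ 4 \<le> t"
  proof -
    obtain j where j: "j \<in> I" using q(1) by (metis card.empty equals0I not_one_le_zero)
    have "(3 * q\<^sup>2) * (3 * q\<^sup>2) \<le> card (group w \<rho> j)" using j q(3) unfolding I sq by simp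
    from differences_of_pierced_chords[OF group_subset _ this pq[OF q(2)]] group_pierced(1,2)[OF _ w, of _ _ \<rho> j]
    show ?thesis unfolding diff_rich_def by metis
  qed
  show "sum_rich (card I div 2) q n (cyc_lens E)" if q: "1 \<le> q" "9 * q ^ 4 \<le> t"
  proof -
    obtain e where e: "bij_betw e {0..<card I} I" using ex_bij_betw_nat_finite[OF finI] by blast
    have sub: "{..<2 * (card I div 2)} \<subseteq> {0..<card I}" by auto
    have einj: "inj_on e {..<2 * (card I div 2)}" using e sub by (meson bij_betw_def inj_on_subset)
    have eI: "e i \<in> I" if "i < 2 * (card I div 2)" for i
      using e sub that by (meson bij_betwE lessThan_iff subsetD)
    have "\<exists>A\<subseteq>{..n}. 2 * q\<^sup>2 \<le> card A \<and> (\<forall>x\<in>A. route (cut w \<rho> j) (cut w \<rho> (Suc j)) x)" if "j \<in> I" for j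
    proof -
      have "(3 * q\<^sup>2) * (3 * q\<^sup>2) \<le> card (group w \<rho> j)" using that q(2) unfolding I sq by simp
      from routes_of_pierced_chords[OF group_subset _ this pq[OF q(1)] _ cut_le, of "w * (3 * j + \<rho> + 1)" "cut w \<rho> j" w \<rho> "Suc j"]
      obtain A where "A \<subseteq> {..n}" "3 * q\<^sup>2 \<le> Suc (card A)" "\<forall>x\<in>A. route (cut w \<rho> j) (cut w \<rho> (Suc j)) x"
        using group_pierced[OF _ w, of _ _ \<rho> j] by metis
      \<comment> \<open>The element lost in \<open>routes_of_pierced_chords\<close> is covered by
        going from \<open>3 * q\<^sup>2\<close> down to \<open>2 * q\<^sup>2\<close>.\<close>
      moreover have "1 \<le> q\<^sup>2" using q(1) by simp
      ultimately show ?thesis by (intro exI[of _ A]) auto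
    qed
    then obtain A where A: "A j \<subseteq> {..n}" "2 * q\<^sup>2 \<le> card (A j)" "\<forall>x\<in>A j. route (cut w \<rho> j) (cut w \<rho> (Suc j)) x" if "j \<in> I" for j
      by metis
    have "\<exists>m. m + (\<Sum>i<2 * (card I div 2). f i) = l \<and> (3 \<le> m \<longrightarrow> m \<in> cyc_lens E)"
      if "\<forall>i<2 * (card I div 2). f i \<in> A (e i)" for f
      using that A(3) eI I by (intro routes_in_windows[OF w einj]) auto
    then show ?thesis unfolding sum_rich_def using A(1,2) eI length_le
      by (intro exI[of _ l] exI[of _ "\<lambda>i. A (e i)"] conjI) auto
  qed
  show "\<exists>J. card I * (card I - 1) \<le> J * n \<and> prog_rich J n (cyc_lens E)"
  proof (cases "2 \<le> card I")
    case True
    have "\<exists>x. x \<in> group w \<rho> j" if "j \<in> I" for j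
      using that t unfolding I by (metis (no_types, lifting) all_not_in_conv card.empty mem_Collect_eq not_one_le_zero order_trans)
    then obtain c where c: "c j \<in> group w \<rho> j" if "j \<in> I" for j by metis
    define len where "len j = snd (c j) - fst (c j)" for j
    have len: "w \<le> len j" "len j < 2 * w" "2 \<le> len j" "len j \<le> n" if "j \<in> I" for j
      using c[OF that] length_le by (auto simp: group_def chords_def len_def)
    \<comment> \<open>There are only \<open>w\<close> possible lengths, so one length
      \<open>y\<close> occurs in at least \<open>card I / w\<close> groups; each of these chords
      saves \<open>y - 1\<close> vertices.\<close>
    have "len \<in> I \<rightarrow> {w..<2 * w}" using len by auto
    then obtain y where y: "card I \<le> card (len -` {y} \<inter> I) * w"
      using pigeonhole_card[of len I "{w..<2 * w}"] finI w by auto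
    define K where "K = len -` {y} \<inter> I"
    have K: "finite K" "K \<subseteq> I" "card I \<le> card K * w" using finI y by (auto simp: K_def)
    have "K \<noteq> {}" using K(3) True by auto
    then obtain j0 where "j0 \<in> K" by blast
    then have y2: "2 \<le> y" "y \<le> n" using len(3,4)[of j0] by (auto simp: K_def)
    \<comment> \<open>Since \<open>w * j < n\<close> for all \<open>j\<close> in \<open>I\<close>,
      there are at most \<open>n div w + 1\<close> groups. This makes up for the factor
      \<open>w\<close> lost in the choice of \<open>y\<close>.\<close>
    have "w * (card I - 1) \<le> n"
    proof -
      have "w * j < n" if "j \<in> I" for j using group_nonempty(2)[OF _ w] c[OF that] by blast
      then have "I \<subseteq> {..n div w}" using w by (auto simp: less_eq_div_iff_mult_less_eq mult.commute less_imp_le)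
      then have "card I \<le> Suc (n div w)" using card_mono[of "{..n div w}" I] by simp
      then have "w * (card I - 1) \<le> w * (n div w)" by (intro mult_le_mono2) simp
      also have "\<dots> \<le> n" by simp
      finally show ?thesis .
    qed
    then have "card I * (card I - 1) \<le> card K * n"
      using K(3) by (metis (no_types, lifting) mult.assoc mult_le_mono1 mult_le_mono2 order_trans)
    moreover have "prog_rich (card K) n (cyc_lens E)"
    proof -
      obtain e where e: "bij_betw e {0..<card K} K" using ex_bij_betw_nat_finite[OF K(1)] by blast
      have "\<exists>m. m + i * (y - 1) = l \<and> (3 \<le> m \<longrightarrow> m \<in> cyc_lens E)" if i: "i \<le> card K" for i
      proof -
        have sub: "{..<i} \<subseteq> {0..<card K}" using i by auto
        have einj: "inj_on e {..<i}" using e sub by (meson bij_betw_def inj_on_subset)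
        have eK: "e k \<in> K" if "k < i" for k using e sub that by (meson bij_betwE lessThan_iff subsetD)
        have "route (cut w \<rho> (e k)) (cut w \<rho> (Suc (e k))) (y - 1)" if "k < i" for k
        proof -
          have ek: "e k \<in> I" "len (e k) = y" using eK[OF that] by (auto simp: K_def)
          have g: "(fst (c (e k)), snd (c (e k))) \<in> group w \<rho> (e k)" using c[OF ek(1)] by simp
          show ?thesis
            using route_chord[OF group_pierced(3)[OF g w] _ group_pierced(4)[OF g w] cut_le] g ek(2)
            by (auto simp: group_def chords_def len_def)
        qed
        from routes_in_windows[OF w einj _ this] show ?thesis using eK K(2) I by fastforce
      qed
      then show ?thesis unfolding prog_rich_def using length_le y2
        by (intro exI[of _ l] exI[of _ "y - 1"] conjI) auto
    qed
    ultimately show ?thesis by blast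
  next
    case False
    \<comment> \<open>With at most one group the claim is trivial for \<open>J = 0\<close>, where
      any difference will do.\<close>
    have "prog_rich 0 n (cyc_lens E)"
      unfolding prog_rich_def using length_le length_ge route_imp_cycle[OF route_refl]
      by (intro exI[of _ l] exI[of _ 1] conjI) auto
    moreover have "card I * (card I - 1) = 0" using False by auto
    ultimately show ?thesis by (intro exI[of _ 0]) simp
  qed
qed

section \<open>Vertices off the cycle and edges besides it\<close>

lemma rich_of_large_degree:
  assumes "l \<le> w" "3 * q\<^sup>2 \<le> card {u. E w u \<and> u < l}"
  shows "diff_rich q n (cyc_lens E)"
  unfolding diff_rich_def using assms common_neighbour_cycle[OF assms(1)] length_le
  by (intro exI[of _ "{u. E w u \<and> u < l}"]) auto

text \<open>These are all edges except those of the path \<open>0, ..., l - 1\<close>, so the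
  closing edge is included. Together with \<open>l\<close> they determine the graph, which is how
  sparse graphs are counted.\<close>

definition extra_edges :: "(nat \<times> nat) set" where
  "extra_edges = {(u, v). E u v \<and> u < v \<and> \<not> (v = Suc u \<and> v < l)}"

lemma bounded': "E x y \<Longrightarrow> y < n"
  using bounded sym by blast

lemma extra_edges_subset: "extra_edges \<subseteq> {..<n} \<times> {..<n}"
  using bounded bounded' by (auto simp: extra_edges_def)

lemma edge_iff_extra_edges:
  "E u v \<longleftrightarrow> (u, v) \<in> extra_edges \<or> (v, u) \<in> extra_edges \<or> (v = Suc u \<and> v < l) \<or> (u = Suc v \<and> u < l)"
proof (cases u v rule: linorder_cases)
  case less
  then show ?thesis using step[of u] by (auto simp: extra_edges_def)
next
  case equal
  then show ?thesis using irrefl by (auto simp: extra_edges_def)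
next
  case greater
  moreover have "E u v \<longleftrightarrow> E v u" using sym by blast
  ultimately show ?thesis using step[of v] by (auto simp: extra_edges_def)
qed

text \<open>An extra edge that is no chord has an end outside the cycle. At most \<open>k\<close>
  vertices lie there, and if each has fewer than \<open>d\<close> neighbours on the cycle, their
  degrees are at most \<open>d + k\<close>; so such edges are less than half of all extra
  edges.\<close>

lemma many_chords_or_large_degree:
  assumes "n - l \<le> k" "2 * k * (d + k) < card extra_edges"
  shows "card extra_edges \<le> 2 * card chords \<or> (\<exists>w\<ge>l. d \<le> card {u. E w u \<and> u < l})"
proof (rule disjCI)
  assume "\<not> (\<exists>w\<ge>l. d \<le> card {u. E w u \<and> u < l})"
  then have small: "card {u. E w u \<and> u < l} < d" if "l \<le> w" for w using that by (meson not_le)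
  have fin: "finite {u. E w u}" for w by (rule finite_subset[of _ "{..<n}"]) (auto dest: bounded')
  have "card {u. E w u} \<le> d + k" if "l \<le> w" for w
  proof -
    have "{u. E w u} \<subseteq> {u. E w u \<and> u < l} \<union> {l..<n}" by (auto dest: bounded')
    then have "card {u. E w u} \<le> card ({u. E w u \<and> u < l} \<union> {l..<n})"
      using fin[of w] by (intro card_mono) auto
    also have "\<dots> \<le> card {u. E w u \<and> u < l} + card {l..<n}" by (rule card_Un_le)
    finally show ?thesis using small[OF that] assms(1) by simp
  qed
  then have "card (\<Union>w\<in>{l..<n}. {u. E w u} \<times> {w}) \<le> (\<Sum>w\<in>{l..<n}. d + k)"
    by (intro order_trans[OF card_UN_le] sum_mono) (auto simp: card_cartesian_product)
  also have "\<dots> \<le> k * (d + k)" using assms(1) by (simp add: mult_le_mono1)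
  finally have *: "card (\<Union>w\<in>{l..<n}. {u. E w u} \<times> {w}) \<le> k * (d + k)" .
  have "extra_edges \<subseteq> chords \<union> (\<Union>w\<in>{l..<n}. {u. E w u} \<times> {w})"
  proof
    fix x assume "x \<in> extra_edges"
    then obtain u v where x: "x = (u, v)" "E u v" "u < v" "\<not> (v = Suc u \<and> v < l)"
      by (auto simp: extra_edges_def)
    show "x \<in> chords \<union> (\<Union>w\<in>{l..<n}. {u. E w u} \<times> {w})"
    proof (cases "v < l")
      case True
      then show ?thesis using x by (simp add: chords_def)
    next
      case False
      then show ?thesis using x(1) sym[OF x(2)] bounded'[OF x(2)] by simp
    qed
  qed
  then have "card extra_edges \<le> card (chords \<union> (\<Union>w\<in>{l..<n}. {u. E w u} \<times> {w}))"
    using finite_chords fin by (intro card_mono) auto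
  also have "\<dots> \<le> card chords + k * (d + k)" using * by (intro order_trans[OF card_Un_le]) simp
  finally show "card extra_edges \<le> 2 * card chords" using assms(2) by simp
qed

end

section \<open>Relabelling a graph along a cycle\<close>

lemma pcas_of_successively:
  assumes "successively (\<lambda>x y. (x, y) \<in> A) (u # xs)"
  shows "\<exists>p. set p \<subseteq> A \<and> pcas u p (last (u # xs)) \<and> pawalk_verts u p = u # xs \<and> length p = length xs"
  using assms
proof (induction xs arbitrary: u)
  case Nil
  then show ?case by (intro exI[of _ "[]"]) simp
next
  case (Cons x xs)
  then obtain p where "set p \<subseteq> A" "pcas x p (last (x # xs))" "pawalk_verts x p = x # xs" "length p = length xs"
    by auto
  then show ?case using Cons.prems by (intro exI[of _ "(u, x) # p"]) auto
qed

lemma successively_of_pcas: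
  assumes "pcas u p v" "set p \<subseteq> A"
  shows "\<exists>xs. pawalk_verts u p = u # xs \<and> successively (\<lambda>x y. (x, y) \<in> A) (u # xs)
    \<and> last (u # xs) = v \<and> length xs = length p"
  using assms
proof (induction p arbitrary: u)
  case Nil
  then show ?case by simp
next
  case (Cons e p)
  then obtain xs where "pawalk_verts (snd e) p = snd e # xs" "successively (\<lambda>x y. (x, y) \<in> A) (snd e # xs)"
    "last (snd e # xs) = v" "length xs = length p"
    by (auto dest: Cons.IH)
  then show ?case using Cons.prems by (intro exI[of _ "snd e # xs"]) (cases e; auto)
qed

lemma cycle_set_eq_cyc_lens:
  assumes "pair_graph G"
  shows "cycle_set G = cyc_lens (\<lambda>x y. (x, y) \<in> parcs G)"
proof -
  interpret pair_graph G by fact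
  show ?thesis
  proof (intro equalityI subsetI)
    fix m assume "m \<in> cycle_set G"
    then obtain u p where p: "m = length p" "3 \<le> length p" "awalk u p u" "distinct (tl (pawalk_verts u p))"
      unfolding cycle_set_def cycle_def by auto
    have "pcas u p u" "set p \<subseteq> parcs G" using p(3) unfolding awalk_def by blast+
    from successively_of_pcas[OF this] obtain xs where xs: "pawalk_verts u p = u # xs" "successively (\<lambda>x y. (x, y) \<in> parcs G) (u # xs)"
      "last (u # xs) = u" "length xs = length p"
      by blast
    \<comment> \<open>The walk lists its start vertex at both ends; without the first copy,
      \<open>xs\<close> is the vertex list of the cycle.\<close>
    have "xs \<noteq> []" using xs(4) p(2) by auto
    then show "m \<in> cyc_lens (\<lambda>x y. (x, y) \<in> parcs G)"
      using xs p by (intro cyc_lensI[of xs]) (auto simp: successively_Cons)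
  next
    fix m assume "m \<in> cyc_lens (\<lambda>x y. (x, y) \<in> parcs G)"
    then obtain vs where vs: "m = length vs" "3 \<le> length vs" "distinct vs"
      "successively (\<lambda>x y. (x, y) \<in> parcs G) vs" "(last vs, hd vs) \<in> parcs G"
      by (auto simp: cyc_lens_def)
    then obtain u xs where u: "vs = u # xs" by (cases vs) auto
    have "successively (\<lambda>x y. (x, y) \<in> parcs G) (u # (xs @ [u]))"
      using vs u successively_append_iff[of _ vs "[u]"] by auto
    from pcas_of_successively[OF this] obtain p where p: "set p \<subseteq> parcs G" "pcas u p u"
      "pawalk_verts u p = u # (xs @ [u])" "length p = length vs"
      using u by auto
    have "u \<in> pverts G" using vs(5) u in_arcsD2 by auto
    then have "awalk u p u" using p(1,2) unfolding awalk_def by blast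
    moreover have "distinct (tl (pawalk_verts u p))" using p(3) vs(3) u by simp
    ultimately have "cycle p" using p(4) vs(2) unfolding cycle_def by auto
    then show "m \<in> cycle_set G" using p(4) vs(1,2) unfolding cycle_set_def by (intro CollectI exI[of _ p]) auto
  qed
qed

lemma successively_closed_subset:
  assumes "successively E vs" "E (last vs) (hd vs)" "vs \<noteq> []" "\<And>x y. E x y \<Longrightarrow> x \<in> V"
  shows "set vs \<subseteq> V"
proof
  fix x assume "x \<in> set vs"
  then obtain i where i: "i < length vs" "x = vs ! i" by (metis in_set_conv_nth)
  show "x \<in> V"
  proof (cases "Suc i < length vs")
    case True
    then have "E (vs ! i) (vs ! Suc i)" using assms(1) by (simp add: successively_conv_nth)
    then show ?thesis unfolding i(2) by (rule assms(4))
  next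
    case False
    then have "length vs - 1 = i" using i(1) by linarith
    then have "last vs = x" using i(2) last_conv_nth[OF assms(3)] by simp
    then show ?thesis using assms(4)[OF assms(2)] by simp
  qed
qed

lemma cyc_lens_mono_inj:
  assumes "inj_on \<phi> V" "\<And>x y. E x y \<Longrightarrow> x \<in> V \<and> y \<in> V \<and> E' (\<phi> x) (\<phi> y)"
  shows "cyc_lens E \<subseteq> cyc_lens E'"
proof
  fix m assume "m \<in> cyc_lens E"
  then obtain vs where vs: "m = length vs" "3 \<le> length vs" "distinct vs" "successively E vs" "E (last vs) (hd vs)"
    by (auto simp: cyc_lens_def)
  have "set vs \<subseteq> V" using vs(2,4,5) assms(2) by (intro successively_closed_subset[of E vs]) auto
  then have "inj_on \<phi> (set vs)" using assms(1) inj_on_subset by blast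
  then have "distinct (map \<phi> vs)" using vs(3) by (simp add: distinct_map)
  moreover have "successively E' (map \<phi> vs)"
    using vs(4) assms(2) by (auto simp: successively_conv_nth)
  moreover have "E' (last (map \<phi> vs)) (hd (map \<phi> vs))"
    using vs(2,5) assms(2) by (cases "vs = []") (auto simp: last_map hd_map)
  ultimately show "m \<in> cyc_lens E'" using vs(1,2) by (intro cyc_lensI[of "map \<phi> vs"]) auto
qed

text \<open>The vertices are listed with the cycle first and renamed to their positions in the list.
  Both this bijection and its inverse carry cycles to cycles by
  \<open>cyc_lens_mono_inj\<close>.\<close>

lemma cycle_graph_of_cycle:
  assumes G: "pair_graph G" and l: "l \<in> cycle_set G"
  shows "\<exists>E. cycle_graph (card (pverts G)) l E \<and> cyc_lens E = cycle_set G"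
proof -
  interpret pair_graph G by fact
  define F where "F x y \<longleftrightarrow> (x, y) \<in> parcs G" for x y
  have "F = (\<lambda>x y. (x, y) \<in> parcs G)" by (simp add: F_def fun_eq_iff)
  then have S: "cycle_set G = cyc_lens F" using cycle_set_eq_cyc_lens[OF G] by simp
  have FV: "x \<in> pverts G" "y \<in> pverts G" if "F x y" for x y
    using that in_arcsD1 in_arcsD2 by (auto simp: F_def)
  obtain vs where vs: "l = length vs" "3 \<le> length vs" "distinct vs" "successively F vs" "F (last vs) (hd vs)"
    using l unfolding S by (auto simp: cyc_lens_def)
  have vsV: "set vs \<subseteq> pverts G" using vs(2,4,5) FV by (intro successively_closed_subset[of F vs]) auto
  obtain ws where ws: "set ws = pverts G - set vs" "distinct ws"
    using finite_distinct_list[of "pverts G - set vs"] pair_finite_verts by auto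
  define us where "us = vs @ ws"
  define n where "n = length us"
  have us: "distinct us" "set us = pverts G" using vs(3) ws vsV by (auto simp: us_def)
  have n: "card (pverts G) = n" using us distinct_card[of us] by (simp add: n_def)
  have bij: "bij_betw ((!) us) {..<n} (pverts G)" using us by (intro bij_betw_nth) (auto simp: n_def)
  define E where "E i j \<longleftrightarrow> i < n \<and> j < n \<and> F (us ! i) (us ! j)" for i j
  have us_vs: "us ! i = vs ! i" if "i < l" for i using that vs(1) by (simp add: us_def nth_append)
  have ln: "l \<le> n" using vs(1) by (simp add: n_def us_def)
  have "cycle_graph n l E"
  proof
    fix x y assume "E x y"
    then show "E y x" "x < n"
      using pair_sym_arcs by (auto simp: E_def F_def symmetric_def sym_def)
  next
    show "\<not> E x x" for x by (auto simp: E_def F_def dest: pair_no_loops)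
    show "3 \<le> l" "l \<le> n" using vs(1,2) ln by simp_all
    show "E i (Suc i)" if "Suc i < l" for i
    proof -
      have "F (vs ! i) (vs ! Suc i)" using vs(4) that vs(1) unfolding successively_conv_nth by blast
      then show ?thesis using that ln by (simp add: E_def us_vs)
    qed
    have "0 < l" "vs \<noteq> []" using vs(1,2) by auto
    moreover from this have "l - 1 < n" "0 < n" using ln by linarith+
    ultimately have "last vs = us ! (l - 1)" "hd vs = us ! 0" "l - 1 < n" "0 < n"
      using us_vs[of "l - 1"] us_vs[of 0] last_conv_nth[of vs] hd_conv_nth[of vs] vs(1) by auto
    then show "E (l - 1) 0" using vs(5) unfolding E_def by metis
  qed
  moreover have "cyc_lens E \<subseteq> cyc_lens F"
    by (rule cyc_lens_mono_inj[OF bij_betw_imp_inj_on[OF bij]]) (simp add: E_def)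
  moreover have "cyc_lens F \<subseteq> cyc_lens E"
  proof (rule cyc_lens_mono_inj[of "the_inv_into {..<n} ((!) us)" "pverts G"])
    show "inj_on (the_inv_into {..<n} ((!) us)) (pverts G)"
      using bij_betw_imp_inj_on[OF bij_betw_the_inv_into[OF bij]] .
    fix x y assume xy: "F x y"
    have "the_inv_into {..<n} ((!) us) z \<in> {..<n} \<and> us ! (the_inv_into {..<n} ((!) us) z) = z" if "z \<in> pverts G" for z
      using bij_betwE[OF bij_betw_the_inv_into[OF bij]] f_the_inv_into_f_bij_betw[OF bij] that by blast
    then show "x \<in> pverts G \<and> y \<in> pverts G \<and> E (the_inv_into {..<n} ((!) us) x) (the_inv_into {..<n} ((!) us) y)"
      using FV[OF xy] xy by (simp add: E_def)
  qed
  ultimately show ?thesis unfolding n S by (intro exI[of _ E]) blast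
qed

section \<open>Counting the cycle sets\<close>

text \<open>Splitting off the \<open>q\<close> largest elements makes all differences between them
  and the rest go in the direction that \<open>diff_rich\<close> speaks about.\<close>

lemma ex_top_subset:
  fixes A :: "nat set"
  assumes "finite A" "q \<le> card A"
  shows "\<exists>Y\<subseteq>A. card Y = q \<and> (\<forall>x\<in>A - Y. \<forall>y\<in>Y. x < y)"
  using assms(2)
proof (induction q)
  case 0
  show ?case by (intro exI[of _ "{}"]) auto
next
  case (Suc q)
  then obtain Y where Y: "Y \<subseteq> A" "card Y = q" "\<forall>x\<in>A - Y. \<forall>y\<in>Y. x < y" by auto
  have finY: "finite Y" using Y(1) assms(1) finite_subset by blast
  have "A - Y \<noteq> {}" using Suc.prems Y(2) finY by (metis Diff_eq_empty_iff card_mono not_less_eq_eq)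
  then have M: "Max (A - Y) \<in> A - Y" "\<And>x. x \<in> A - Y \<Longrightarrow> x \<le> Max (A - Y)" using assms(1) by (auto intro: Max_in[OF finite_Diff, THEN DiffD1] dest: Max_in[OF finite_Diff])
  have "x < y" if "x \<in> A - insert (Max (A - Y)) Y" "y \<in> insert (Max (A - Y)) Y" for x y
    using that M Y(3) by (metis DiffD1 DiffD2 DiffI insertCI insertE le_neq_implies_less)
  then show ?case using M(1) Y(1,2) finY by (intro exI[of _ "insert (Max (A - Y)) Y"]) auto
qed

lemma power_double: "(2::nat) ^ a * 2 ^ a = 2 ^ (2 * a)"
  by (simp add: mult_2 power_add)

text \<open>An element is one of \<open>m + 1\<close> numbers or a blank, so it costs
  \<open>L\<close> bits.\<close>

lemma card_small_subsets_le:
  fixes m :: nat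
  assumes "m + 2 \<le> 2 ^ L"
  shows "finite {X. X \<subseteq> {..m} \<and> card X \<le> q} \<and> card {X. X \<subseteq> {..m} \<and> card X \<le> q} \<le> 2 ^ (L * q)"
proof -
  have "Suc (card {..m}) ^ q \<le> (2 ^ L) ^ q" using assms by (intro power_mono) auto
  then show ?thesis
    using card_bounded_subsets[of "{..m}" q] by (simp add: power_mult[symmetric])
qed

text \<open>The core consists of the lengths \<open>y - x + 2\<close> for \<open>q\<close> top
  elements \<open>y\<close> and at most \<open>q\<close> lower elements \<open>x\<close>, which by
  \<open>sumset_of_few_elements\<close> are at least \<open>q\<^sup>2 / 2\<close> many. These
  elements go up to \<open>2 * n\<close>, hence \<open>L + 1\<close> bits for each.\<close>

lemma card_diff_rich:
  assumes "n + 2 \<le> 2 ^ L" "2 * g \<le> q\<^sup>2"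
  shows "card {S. S \<subseteq> {3..n} \<and> diff_rich q n S} * 2 ^ g \<le> 2 ^ (2 * (L + 1) * q) * 2 ^ n"
proof -
  define f :: "nat \<Rightarrow> nat \<Rightarrow> nat" where "f x y = y - x + 2" for x y
  define W where "W = {X. X \<subseteq> {..2 * n} \<and> card X \<le> q}"
  have W: "finite W" "card W \<le> 2 ^ ((L + 1) * q)"
    using card_small_subsets_le[of "2 * n" "L + 1" q] assms(1) by (auto simp: W_def)
  define \<B> where "\<B> = (\<lambda>(X, Y). case_prod f ` (X \<times> Y)) ` (W \<times> W)"
  have "\<exists>B\<in>\<B>. B \<subseteq> S \<and> g \<le> card B" if S: "diff_rich q n S" for S
  proof -
    obtain A where A: "A \<subseteq> {..2 * n}" "3 * q\<^sup>2 \<le> card A" "\<forall>x\<in>A. \<forall>y\<in>A. x < y \<longrightarrow> y - x + 2 \<in> S"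
      using S unfolding diff_rich_def by blast
    have finA: "finite A" using A(1) finite_subset by blast
    have "q \<le> q\<^sup>2" by (simp add: power2_eq_square)
    then obtain Y where Y: "Y \<subseteq> A" "card Y = q" "\<forall>x\<in>A - Y. \<forall>y\<in>Y. x < y"
      using ex_top_subset[OF finA, of q] A(2) by auto
    have finY: "finite Y" using Y(1) finA finite_subset by blast
    have "card (A - Y) = card A - q" using Y finY by (simp add: card_Diff_subset)
    \<comment> \<open>The constant \<open>3\<close> in \<open>diff_rich\<close> leaves
      \<open>2 * q\<^sup>2\<close> elements after the removal of \<open>Y\<close>.\<close>
    then have "2 * q\<^sup>2 \<le> card (A - Y)" using A(2) \<open>q \<le> q\<^sup>2\<close> by linarith
    moreover have "inj_on (\<lambda>x. f x y) (A - Y)" if "y \<in> Y" for y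
    proof (rule inj_onI)
      fix a b assume "a \<in> A - Y" "b \<in> A - Y" "f a y = f b y"
      moreover from this have "a < y" "b < y" using Y(3) that by blast+
      ultimately show "a = b" by (simp add: f_def)
    qed
    moreover have "inj_on (f x) Y" if "x \<in> A - Y" for x
    proof (rule inj_onI)
      fix a b assume "a \<in> Y" "b \<in> Y" "f x a = f x b"
      moreover from this have "x < a" "x < b" using Y(3) that by blast+
      ultimately show "a = b" by (simp add: f_def)
    qed
    ultimately obtain X where X: "X \<subseteq> A - Y" "card X \<le> q" "q\<^sup>2 \<le> 2 * card (case_prod f ` (X \<times> Y))"
      using sumset_of_few_elements[of "A - Y" q Y f] finA finY Y(2) by auto
    have "X \<in> W" "Y \<in> W" using X(1,2) Y(1,2) A(1) unfolding W_def by blast+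
    then have "case_prod f ` (X \<times> Y) \<in> \<B>" unfolding \<B>_def by (intro image_eqI[of _ _ "(X, Y)"]) auto
    moreover have "case_prod f ` (X \<times> Y) \<subseteq> S"
    proof
      fix z assume "z \<in> case_prod f ` (X \<times> Y)"
      then obtain x y where "x \<in> X" "y \<in> Y" "z = f x y" by auto
      then show "z \<in> S" using X(1) Y(1,3) A(3) unfolding f_def by blast
    qed
    moreover have "g \<le> card (case_prod f ` (X \<times> Y))" using X(3) assms(2) by linarith
    ultimately show ?thesis by blast
  qed
  then have "card {S. S \<subseteq> {3..n} \<and> diff_rich q n S} * 2 ^ g \<le> card \<B> * 2 ^ card {3..n}"
    using W(1) by (intro card_supersets_le) (auto simp: \<B>_def)
  also have "\<dots> \<le> 2 ^ (2 * (L + 1) * q) * 2 ^ n"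
  proof (intro mult_le_mono power_increasing)
    have "card \<B> \<le> card W * card W"
      unfolding \<B>_def using W(1) by (metis card_cartesian_product card_image_le finite_cartesian_product)
    also have "\<dots> \<le> 2 ^ ((L + 1) * q) * 2 ^ ((L + 1) * q)" using W(2) by (intro mult_le_mono)
    finally show "card \<B> \<le> 2 ^ (2 * (L + 1) * q)" unfolding power_double by (simp only: mult.assoc)
  qed auto
  finally show ?thesis .
qed

text \<open>The core is a progression and thus described by \<open>l\<close> and \<open>x\<close>
  alone.\<close>

lemma card_prog_rich:
  assumes "n + 2 \<le> 2 ^ L"
  shows "card {S. S \<subseteq> {3..n} \<and> prog_rich (g + 2) n S} * 2 ^ g \<le> 2 ^ (2 * L) * 2 ^ n"
proof -
  define \<B> where "\<B> = (\<lambda>(l, x). (\<lambda>j. l - j * x) ` {..g + 2} - {..<3}) ` ({..n} \<times> {..n})"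
  have "\<exists>B\<in>\<B>. B \<subseteq> S \<and> g \<le> card B" if S: "prog_rich (g + 2) n S" for S
  proof -
    obtain l x where lx: "l \<le> n" "1 \<le> x" "x \<le> n" "\<forall>j\<le>g + 2. \<exists>m. m + j * x = l \<and> (3 \<le> m \<longrightarrow> m \<in> S)"
      using S unfolding prog_rich_def by blast
    let ?M = "(\<lambda>j. l - j * x) ` {..g + 2}"
    have jx: "j * x \<le> l" if "j \<le> g + 2" for j using lx(4) that by (metis le_add2)
    have "inj_on (\<lambda>j. l - j * x) {..g + 2}"
    proof (rule inj_onI)
      fix i j assume "i \<in> {..g + 2}" "j \<in> {..g + 2}" "l - i * x = l - j * x"
      then have "i * x = j * x" using jx[of i] jx[of j] by (metis atMost_iff diff_diff_cancel)
      then show "i = j" using lx(2) by simp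
    qed
    then have "card ?M = g + 3" by (simp add: card_image)
    \<comment> \<open>Of the \<open>g + 3\<close> terms at most three are below \<open>3\<close> and
      give no cycle.\<close>
    then have "g \<le> card (?M - {..<3})" using diff_card_le_card_Diff[of "{..<3::nat}" ?M] by simp
    moreover have "?M - {..<3} \<subseteq> S"
    proof
      fix z assume z: "z \<in> ?M - {..<3}"
      then obtain j where "j \<le> g + 2" "z = l - j * x" by auto
      moreover from this obtain m where "m + j * x = l" "3 \<le> m \<longrightarrow> m \<in> S" using lx(4) by blast
      ultimately show "z \<in> S" using z by auto
    qed
    moreover have "?M - {..<3} \<in> \<B>" unfolding \<B>_def using lx by (intro image_eqI[of _ _ "(l, x)"]) auto
    ultimately show ?thesis by blast
  qed
  then have "card {S. S \<subseteq> {3..n} \<and> prog_rich (g + 2) n S} * 2 ^ g \<le> card \<B> * 2 ^ card {3..n}"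
    by (intro card_supersets_le) (auto simp: \<B>_def)
  also have "\<dots> \<le> 2 ^ (2 * L) * 2 ^ n"
  proof (intro mult_le_mono power_increasing)
    have "card \<B> \<le> card ({..n} \<times> {..n})" unfolding \<B>_def by (intro card_image_le) auto
    also have "\<dots> \<le> 2 ^ L * 2 ^ L" unfolding card_cartesian_product using assms by (intro mult_le_mono) auto
    finally show "card \<B> \<le> 2 ^ (2 * L)" by (simp add: power_add[symmetric] mult_2)
  qed auto
  finally show ?thesis .
qed

lemma sum_lessThan_double:
  fixes F :: "nat \<Rightarrow> nat"
  shows "(\<Sum>i<2 * g. F i) = (\<Sum>p<g. F (2 * p) + F (2 * p + 1))"
  by (induction g) auto

text \<open>In each pair of windows, at most \<open>q\<close> elements of either set have more than
  \<open>k\<close> sums. Adding over the \<open>g\<close> pairs gives more than \<open>g * k\<close>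
  sums by \<open>card_sums_of_ge\<close>, and the core is described by \<open>l\<close> and at most
  \<open>2 * q\<close> numbers for each pair.\<close>

lemma card_sum_rich:
  assumes "n + 2 \<le> 2 ^ L" "2 * (k + 1) \<le> q\<^sup>2"
  shows "card {S. S \<subseteq> {3..n} \<and> sum_rich g q n S} * 2 ^ (g * k - 2) \<le> 2 ^ (L + 2 * L * q * g) * 2 ^ n"
proof -
  define W where "W = {X. X \<subseteq> {..n} \<and> card X \<le> q}"
  have W: "finite W" "card W \<le> 2 ^ (L * q)"
    using card_small_subsets_le[OF assms(1), of q] by (auto simp: W_def)
  define P where "P = (\<lambda>(X, Y). case_prod (+) ` (X \<times> Y)) ` (W \<times> W)"
  have "card P \<le> card W * card W"
    unfolding P_def using W(1) by (metis card_cartesian_product card_image_le finite_cartesian_product)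
  also have "\<dots> \<le> 2 ^ (L * q) * 2 ^ (L * q)" using W(2) by (intro mult_le_mono)
  finally have P: "card P \<le> 2 ^ (2 * L * q)" "finite P"
    using W(1) unfolding power_double by (simp_all only: mult.assoc) (simp add: P_def)
  define \<B> where "\<B> = (\<lambda>(l, B). (\<lambda>s. l - s) ` sums_of g B - {..<3}) ` ({..n} \<times> ({..<g} \<rightarrow>\<^sub>E P))"
  have fin: "finite ({..n} \<times> ({..<g} \<rightarrow>\<^sub>E P))" using P(2) by (intro finite_cartesian_product finite_PiE) auto
  have "\<exists>B\<in>\<B>. B \<subseteq> S \<and> g * k - 2 \<le> card B" if S: "sum_rich g q n S" for S
  proof -
    obtain l A where l: "l \<le> n" and A: "\<And>i. i < 2 * g \<Longrightarrow> A i \<subseteq> {..n} \<and> 2 * q\<^sup>2 \<le> card (A i)"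
      and cyc: "\<And>f. (\<forall>i<2 * g. f i \<in> A i) \<Longrightarrow> \<exists>m. m + (\<Sum>i<2 * g. f i) = l \<and> (3 \<le> m \<longrightarrow> m \<in> S)"
      using S unfolding sum_rich_def by blast
    have "\<exists>X Y. X \<subseteq> A (2 * p) \<and> Y \<subseteq> A (2 * p + 1) \<and> card X \<le> q \<and> card Y \<le> q \<and> q\<^sup>2 \<le> 2 * card (case_prod (+) ` (X \<times> Y))"
      if "p < g" for p
    proof -
      have A1: "A (2 * p) \<subseteq> {..n}" "2 * q\<^sup>2 \<le> card (A (2 * p))" and A2: "A (2 * p + 1) \<subseteq> {..n}" "2 * q\<^sup>2 \<le> card (A (2 * p + 1))"
        using A[of "2 * p"] A[of "2 * p + 1"] that by auto
      have "q \<le> q\<^sup>2" by (simp add: power2_eq_square)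
      then have "q \<le> card (A (2 * p + 1))" using A2(2) by linarith
      then obtain Y where Y: "Y \<subseteq> A (2 * p + 1)" "card Y = q" "finite Y"
        by (metis obtain_subset_with_card_n)
      have "finite (A (2 * p))" using A1(1) finite_subset by blast
      from sumset_of_few_elements[OF this A1(2) Y(3,2), of "(+)"] obtain X where
        "X \<subseteq> A (2 * p)" "card X \<le> q" "q\<^sup>2 \<le> 2 * card (case_prod (+) ` (X \<times> Y))" by (auto simp: inj_on_def)
      then show ?thesis using Y by (intro exI[of _ X] exI[of _ Y]) auto
    qed
    then obtain X Y where XY: "\<And>p. p < g \<Longrightarrow> X p \<subseteq> A (2 * p)" "\<And>p. p < g \<Longrightarrow> Y p \<subseteq> A (2 * p + 1)"
      "\<And>p. p < g \<Longrightarrow> card (X p) \<le> q" "\<And>p. p < g \<Longrightarrow> card (Y p) \<le> q"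
      "\<And>p. p < g \<Longrightarrow> q\<^sup>2 \<le> 2 * card (case_prod (+) ` (X p \<times> Y p))"
      by metis
    \<comment> \<open>The restriction makes \<open>B\<close> extensional, so that it lies in the
      finite function space over which \<open>\<B>\<close> ranges.\<close>
    define B where "B = restrict (\<lambda>p. case_prod (+) ` (X p \<times> Y p)) {..<g}"
    have "B \<in> {..<g} \<rightarrow>\<^sub>E P"
    proof (rule PiE_I)
      fix p assume "p \<in> {..<g}"
      then have p: "p < g" by simp
      have "2 * p < 2 * g" "2 * p + 1 < 2 * g" using p by auto
      then have "X p \<in> W" "Y p \<in> W" using XY(1-4)[OF p] A unfolding W_def by blast+
      then show "B p \<in> P" unfolding P_def B_def using p by (intro image_eqI[of _ _ "(X p, Y p)"]) auto
    qed (simp add: B_def)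
    have sums: "\<exists>m. m + s = l \<and> (3 \<le> m \<longrightarrow> m \<in> S)" if s: "s \<in> sums_of g B" for s
    proof -
      obtain f where f: "s = (\<Sum>p<g. f p)" "\<And>p. p < g \<Longrightarrow> f p \<in> B p" using s unfolding sums_of_def by blast
      have "\<exists>x y. x \<in> X p \<and> y \<in> Y p \<and> f p = x + y" if "p < g" for p
        using f(2)[OF that] that by (auto simp: B_def)
      then obtain x y where xy: "\<And>p. p < g \<Longrightarrow> x p \<in> X p \<and> y p \<in> Y p \<and> f p = x p + y p" by metis
      \<comment> \<open>The choices for a pair \<open>p\<close> go back to the windows
        \<open>2 * p\<close> and \<open>2 * p + 1\<close>.\<close>
      define F where "F i = (if even i then x (i div 2) else y (i div 2))" for i :: nat
      have "F i \<in> A i" if "i < 2 * g" for i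
      proof (cases "even i")
        case True
        then obtain p where "i = 2 * p" by blast
        then show ?thesis using that xy[of p] XY(1)[of p] by (auto simp: F_def)
      next
        case False
        then obtain p where "i = 2 * p + 1" by (rule oddE)
        then show ?thesis using that xy[of p] XY(2)[of p] by (auto simp: F_def)
      qed
      then have "\<exists>m. m + (\<Sum>i<2 * g. F i) = l \<and> (3 \<le> m \<longrightarrow> m \<in> S)" by (intro cyc) simp
      moreover have "(\<Sum>i<2 * g. F i) = s"
        unfolding sum_lessThan_double f(1) using xy by (intro sum.cong) (auto simp: F_def)
      ultimately show ?thesis by simp
    qed
    have "finite (B p) \<and> k < card (B p)" if p: "p < g" for p
    proof -
      have "2 * p < 2 * g" "2 * p + 1 < 2 * g" using p by auto
      then have "finite (X p)" "finite (Y p)" using XY(1,2)[OF p] A by (meson finite_atMost finite_subset)+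
      then show ?thesis using XY(5)[OF p] assms(2) p by (auto simp: B_def)
    qed
    then have cs: "finite (sums_of g B)" "g * k < card (sums_of g B)" using card_sums_of_ge[of g B k] by auto
    let ?M = "(\<lambda>s. l - s) ` sums_of g B"
    have "inj_on (\<lambda>s. l - s) (sums_of g B)"
    proof (rule inj_onI)
      fix s s' assume "s \<in> sums_of g B" "s' \<in> sums_of g B" "l - s = l - s'"
      moreover from this have "s \<le> l" "s' \<le> l" using sums by fastforce+
      ultimately show "s = s'" by simp
    qed
    then have "card ?M = card (sums_of g B)" by (rule card_image)
    \<comment> \<open>More than \<open>g * k\<close> values, without the three values below
      \<open>3\<close>.\<close>
    then have "g * k - 2 \<le> card (?M - {..<3})"
      using diff_card_le_card_Diff[of "{..<3::nat}" ?M] cs(2) by simp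
    moreover have "?M - {..<3} \<subseteq> S"
    proof
      fix z assume z: "z \<in> ?M - {..<3}"
      then obtain s where s: "s \<in> sums_of g B" "z = l - s" by blast
      from sums[OF s(1)] obtain m where "m + s = l" "3 \<le> m \<longrightarrow> m \<in> S" by blast
      then show "z \<in> S" using z s(2) by auto
    qed
    moreover have "?M - {..<3} \<in> \<B>"
      unfolding \<B>_def using l \<open>B \<in> {..<g} \<rightarrow>\<^sub>E P\<close> by (intro image_eqI[of _ _ "(l, B)"]) auto
    ultimately show ?thesis by blast
  qed
  then have "card {S. S \<subseteq> {3..n} \<and> sum_rich g q n S} * 2 ^ (g * k - 2) \<le> card \<B> * 2 ^ card {3..n}"
    using fin by (intro card_supersets_le) (auto simp: \<B>_def)
  also have "\<dots> \<le> 2 ^ (L + 2 * L * q * g) * 2 ^ n"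
  proof (intro mult_le_mono power_increasing)
    have "card \<B> \<le> card ({..n} \<times> ({..<g} \<rightarrow>\<^sub>E P))" unfolding \<B>_def using fin by (rule card_image_le)
    also have "\<dots> = (n + 1) * card P ^ g" by (simp add: card_cartesian_product card_PiE)
    also have "\<dots> \<le> 2 ^ L * (2 ^ (2 * L * q)) ^ g" using assms(1) P(1) by (intro mult_le_mono power_mono) auto
    finally show "card \<B> \<le> 2 ^ (L + 2 * L * q * g)" by (simp add: power_add power_mult[symmetric])
  qed auto
  finally show ?thesis .
qed

definition sparse_cycle_sets :: "nat \<Rightarrow> nat \<Rightarrow> nat set set" where
  "sparse_cycle_sets n t = {cyc_lens E | E l. cycle_graph n l E \<and> card (cycle_graph.extra_edges l E) \<le> t}"

text \<open>By \<open>edge_iff_extra_edges\<close> the graph is determined by \<open>l\<close> and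
  its extra edges, each of which costs \<open>2 * L\<close> bits.\<close>

lemma card_sparse_cycle_sets:
  assumes "n + 2 \<le> 2 ^ L"
  shows "finite (sparse_cycle_sets n t) \<and> card (sparse_cycle_sets n t) \<le> 2 ^ (L + 2 * L * t)"
proof -
  define \<F> where "\<F> = {X. X \<subseteq> {..<n} \<times> {..<n} \<and> card X \<le> t}"
  have \<F>: "finite \<F>" "card \<F> \<le> Suc (card ({..<n} \<times> {..<n})) ^ t"
    using card_bounded_subsets[of "{..<n} \<times> {..<n}" t] by (auto simp: \<F>_def)
  define h where "h = (\<lambda>(l, X). cyc_lens (\<lambda>u v. (u, v) \<in> X \<or> (v, u) \<in> X \<or> (v = Suc u \<and> v < l) \<or> (u = Suc v \<and> u < l)))"
  have "sparse_cycle_sets n t \<subseteq> h ` ({..n} \<times> \<F>)"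
  proof
    fix S assume "S \<in> sparse_cycle_sets n t"
    then obtain E l where E: "S = cyc_lens E" "cycle_graph n l E" "card (cycle_graph.extra_edges l E) \<le> t"
      by (auto simp: sparse_cycle_sets_def)
    interpret cycle_graph n l E by fact
    have "E = (\<lambda>u v. (u, v) \<in> extra_edges \<or> (v, u) \<in> extra_edges \<or> (v = Suc u \<and> v < l) \<or> (u = Suc v \<and> u < l))"
      unfolding fun_eq_iff by (intro allI edge_iff_extra_edges)
    then have "S = h (l, extra_edges)" unfolding E(1) h_def by simp
    moreover have "(l, extra_edges) \<in> {..n} \<times> \<F>"
      using E(3) extra_edges_subset length_le by (simp add: \<F>_def)
    ultimately show "S \<in> h ` ({..n} \<times> \<F>)" by (rule image_eqI)
  qed
  moreover have "finite ({..n} \<times> \<F>)" using \<F>(1) by simp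
  ultimately have 1: "finite (sparse_cycle_sets n t)" "card (sparse_cycle_sets n t) \<le> card ({..n} \<times> \<F>)"
    by (metis finite_surj, metis surj_card_le)
  have "Suc (n * n) \<le> (n + 2) * (n + 2)" by simp
  also have "\<dots> \<le> 2 ^ L * 2 ^ L" using assms by (intro mult_le_mono)
  finally have "Suc (n * n) \<le> 2 ^ (2 * L)" by (simp add: power_add[symmetric] mult_2)
  then have "card \<F> \<le> (2 ^ (2 * L)) ^ t"
    using \<F>(2) power_mono[of "Suc (n * n)" "2 ^ (2 * L)" t] by (simp add: card_cartesian_product)
  then have "card ({..n} \<times> \<F>) \<le> 2 ^ L * (2 ^ (2 * L)) ^ t"
    unfolding card_cartesian_product using assms by (intro mult_le_mono) auto
  then show ?thesis using 1 by (simp add: power_add power_mult[symmetric])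
qed

section \<open>Choice of parameters and the case distinction\<close>

lemma prog_rich_mono:
  assumes "prog_rich J n S" "J' \<le> J"
  shows "prog_rich J' n S"
  using assms unfolding prog_rich_def by (meson le_trans)

text \<open>For polylogarithmic \<open>\<tau>\<close> the number \<open>N\<close> of groups is at
  least \<open>n / (2 ^ 31 * L ^ 7)\<close>. A small \<open>J\<close> would give
  \<open>N * N \<le> 4 * r\<^sup>2 * n\<close>, hence
  \<open>n \<le> 2 ^ 64 * L ^ 14 * r\<^sup>2\<close>, contrary to the lower bounds on
  \<open>n\<close> and \<open>r\<close>.\<close>

lemma prog_length_ge:
  fixes n L r N J \<tau> :: nat
  assumes L: "1 \<le> L" and r: "2 ^ 30 * L ^ 6 \<le> r" and n: "2 ^ 24 * r ^ 4 * L ^ 3 \<le> n"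
    and N: "n \<le> 96 * L ^ 3 * (\<tau> * N)" "2 \<le> N" and \<tau>: "\<tau> \<le> 2 ^ 24 * L ^ 4"
    and J: "N * (N - 1) \<le> J * n"
  shows "r\<^sup>2 + 2 * L + 2 \<le> J"
proof (rule ccontr)
  assume "\<not> ?thesis"
  then have J': "J \<le> r\<^sup>2 + 2 * L + 2" by simp
  have "L * 1 \<le> L * L ^ 5" using L by (intro mult_le_mono2) simp
  then have L6: "L \<le> L ^ 6" by (simp add: power_Suc[symmetric] del: power_Suc)
  then have r4: "4 * L \<le> r" using r by simp
  then have r1: "1 \<le> r" using L by linarith
  have "r * 1 \<le> r * r" using r1 by (intro mult_le_mono2)
  then have "r \<le> r\<^sup>2" by (simp add: power2_eq_square)
  then have "2 * L + 2 \<le> r\<^sup>2" using r4 L by linarith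
  then have J2: "J \<le> 2 * r\<^sup>2" using J' by linarith
  have "n \<le> 96 * L ^ 3 * (2 ^ 24 * L ^ 4 * N)"
    using N(1) \<tau> by (meson le_trans mult_le_mono1 mult_le_mono2)
  also have "\<dots> = (96 * 2 ^ 24) * (L ^ 7 * N)" by (simp add: algebra_simps power_add[symmetric])
  also have "\<dots> \<le> 2 ^ 31 * (L ^ 7 * N)" by (intro mult_le_mono1) simp
  finally have n1: "n \<le> 2 ^ 31 * (L ^ 7 * N)" .
  have "N * N \<le> N * (2 * (N - 1))" using N(2) by (intro mult_le_mono2) simp
  also have "\<dots> \<le> 2 * (J * n)" using J by simp
  also have "\<dots> \<le> 2 * ((2 * r\<^sup>2) * n)" using J2 by (intro mult_le_mono2 mult_le_mono1)
  finally have N2: "N * N \<le> 4 * r\<^sup>2 * n" by simp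
  have "n * n \<le> (2 ^ 31 * (L ^ 7 * N)) * (2 ^ 31 * (L ^ 7 * N))" using n1 by (intro mult_le_mono)
  also have "\<dots> = 2 ^ 62 * L ^ 14 * (N * N)" by (simp add: algebra_simps power_add[symmetric])
  also have "\<dots> \<le> 2 ^ 62 * L ^ 14 * (4 * r\<^sup>2 * n)" using N2 by (intro mult_le_mono2)
  finally have "n * n \<le> (2 ^ 64 * L ^ 14 * r\<^sup>2) * n" by (simp add: algebra_simps)
  moreover have "0 < n" using n r1 L by (metis gr0I le_zero_eq mult_eq_0_iff not_one_le_zero power_not_zero zero_neq_numeral)
  ultimately have "n \<le> 2 ^ 64 * L ^ 14 * r\<^sup>2" by simp
  then have "2 ^ 24 * r ^ 4 * L ^ 3 \<le> 2 ^ 64 * L ^ 14 * r\<^sup>2" by (rule le_trans[OF n])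
  moreover have "2 ^ 24 * r ^ 4 * L ^ 3 = r\<^sup>2 * (2 ^ 24 * r\<^sup>2 * L ^ 3)"
    by (simp add: algebra_simps power_add[symmetric])
  ultimately have "r\<^sup>2 * (2 ^ 24 * r\<^sup>2 * L ^ 3) \<le> r\<^sup>2 * (2 ^ 64 * L ^ 14)" by (simp add: algebra_simps)
  then have upper: "2 ^ 24 * r\<^sup>2 * L ^ 3 \<le> 2 ^ 64 * L ^ 14" using r1 by simp
  have "L ^ 12 * L ^ 3 = L ^ 14 * L" using power_add[of L 12 3] power_Suc2[of L 14] by simp
  moreover have "2 ^ 24 * (2 ^ 30 * L ^ 6)\<^sup>2 * L ^ 3 = 2 ^ 84 * (L ^ 12 * L ^ 3)"
    by (simp add: power_mult_distrib)
  ultimately have "2 ^ 84 * (L ^ 14 * L) = 2 ^ 24 * (2 ^ 30 * L ^ 6)\<^sup>2 * L ^ 3" by simp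
  also have "\<dots> \<le> 2 ^ 24 * r\<^sup>2 * L ^ 3"
    using r by (intro mult_le_mono1 mult_le_mono2 power_mono) auto
  also note upper
  finally have "2 ^ 84 * (L ^ 14 * L) \<le> 2 ^ 64 * L ^ 14" .
  moreover have "2 ^ 84 * (L ^ 14 * 1) \<le> 2 ^ 84 * (L ^ 14 * L)" using L by (intro mult_le_mono2)
  ultimately have "2 ^ 84 * (L ^ 14 * 1) \<le> 2 ^ 64 * L ^ 14" by (rule le_trans[rotated])
  then show False using L by simp
qed

text \<open>Here \<open>r\<^sup>2\<close> is the number of bits to be saved and \<open>L\<close> the
  number of bits of a vertex. With a cycle longer than \<open>n - r\<^sup>2\<close> and many extra
  edges, the outcome depends on the degrees outside the cycle and then on the group size
  \<open>\<tau>\<close>: large, polylogarithmic or in between.\<close>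

lemma cycle_sets_cases:
  assumes L: "n + 2 \<le> 2 ^ L" "1 \<le> L" and r: "2 ^ 30 * L ^ 6 \<le> r" and n: "2 ^ 24 * r ^ 4 * L ^ 3 \<le> n"
    and S: "S \<in> cycle_sets n"
  shows "S \<subseteq> {3..n - r\<^sup>2} \<or> S \<in> sparse_cycle_sets n (n div (8 * L)) \<or>
    (S \<subseteq> {3..n} \<and> (diff_rich (2 * r) n S \<or> prog_rich (r\<^sup>2 + 2 * L + 2) n S \<or>
      (\<exists>g\<le>n. \<exists>q<2 * r. 32 * L \<le> q \<and> 8 * r\<^sup>2 \<le> g * q\<^sup>2 \<and> sum_rich g q n S)))"
proof -
  obtain G :: "nat pair_pre_digraph" where G: "pair_graph G" "card (pverts G) = n" "S = cycle_set G"
    using S unfolding cycle_sets_def by blast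
  have S3: "S \<subseteq> {3..n}" using cycle_set_subset[OF G(1)] G(2,3) by simp
  define t where "t = n div (8 * L)"
  have r1: "1 \<le> r" using r L(2) by (metis le_trans mult_is_0 not_less_eq_eq One_nat_def le_zero_eq power_eq_0_iff zero_neq_numeral)
  show ?thesis
  proof (cases "S \<subseteq> {3..n - r\<^sup>2}")
    case False
    then obtain l where l: "l \<in> S" "n - r\<^sup>2 < l" using S3 by fastforce
    obtain E where E: "cycle_graph n l E" "cyc_lens E = S"
      using cycle_graph_of_cycle[OF G(1)] l(1) G(2,3) by blast
    interpret cycle_graph n l E by fact
    show ?thesis
    proof (cases "card extra_edges \<le> t")
      case True
      then have "S \<in> sparse_cycle_sets n t" unfolding sparse_cycle_sets_def using E by blast
      then show ?thesis by (simp add: t_def)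
    next
      case False
      \<comment> \<open>\<open>many_chords_or_large_degree\<close> is to be applied with
        \<open>k = r\<^sup>2\<close> and \<open>d = 12 * r\<^sup>2\<close>, which is the
        \<open>3 * (2 * r)\<^sup>2\<close> of \<open>diff_rich (2 * r)\<close>. This requires
        \<open>26 * r ^ 4 \<le> t\<close>.\<close>
      have "L * 1 \<le> L * L\<^sup>2" using L(2) by (intro mult_le_mono2) simp
      then have "L \<le> L ^ 3" by (simp add: power2_eq_square power3_eq_cube)
      then have "208 * r ^ 4 * L \<le> 2 ^ 24 * r ^ 4 * L ^ 3" by (intro mult_le_mono) auto
      then have "208 * r ^ 4 * L \<le> n" by (rule le_trans[OF _ n])
      then have "26 * r ^ 4 * (8 * L) \<le> n" by (simp add: algebra_simps)
      then have "26 * r ^ 4 \<le> t" unfolding t_def using L(2) by (simp add: less_eq_div_iff_mult_less_eq)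
      moreover have "2 * r\<^sup>2 * (12 * r\<^sup>2 + r\<^sup>2) = 26 * r ^ 4" by (simp add: power2_eq_square power4_eq_xxxx)
      ultimately have "2 * r\<^sup>2 * (12 * r\<^sup>2 + r\<^sup>2) < card extra_edges" using False by linarith
      moreover have "n - l \<le> r\<^sup>2" using l(2) by linarith
      ultimately consider "card extra_edges \<le> 2 * card chords" | w where "l \<le> w" "12 * r\<^sup>2 \<le> card {u. E w u \<and> u < l}"
        using many_chords_or_large_degree[of "r\<^sup>2" "12 * r\<^sup>2"] by blast
      then show ?thesis
      proof cases
        case 2
        then have "diff_rich (2 * r) n S" using rich_of_large_degree[of w "2 * r"] E(2) by (simp add: power_mult_distrib)
        then show ?thesis using S3 by blast
      next
        case 1
        have "n < 2 ^ L" "0 < L" using L by simp_all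
        from chords_groups[OF this] obtain w \<rho> h where w: "0 < w"
          "card chords \<le> 6 * L\<^sup>2 * (2 ^ h * card {j\<in>{..<l}. 2 ^ h \<le> card (group w \<rho> j)})"
          by blast
        define I where "I = {j\<in>{..<l}. 2 ^ h \<le> card (group w \<rho> j)}"
        define N where "N = card I"
        define \<tau> :: nat where "\<tau> = 2 ^ h"
        have \<tau>1: "1 \<le> \<tau>" by (simp add: \<tau>_def)
        have I_eq: "I = {j\<in>{..<l}. \<tau> \<le> card (group w \<rho> j)}" by (simp add: I_def \<tau>_def)
        note rich = rich_of_groups[OF w(1) I_eq \<tau>1, folded N_def, unfolded E(2)]
        have "N \<le> card {..<l}" unfolding N_def I_def by (intro card_mono) auto
        then have Nn: "N \<le> n" using length_le by simp
        \<comment> \<open>There are more than \<open>t\<close> extra edges, at most twice as many as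
          chords. The factor \<open>8 * L\<close> then recovers \<open>n\<close> from
          \<open>t\<close>.\<close>
        have "t + 1 \<le> 2 * (6 * L\<^sup>2 * (\<tau> * N))" using w(2) 1 False unfolding N_def I_def \<tau>_def by linarith
        then have "8 * L * (t + 1) \<le> 8 * L * (2 * (6 * L\<^sup>2 * (\<tau> * N)))" by (rule mult_le_mono2)
        also have "\<dots> = 96 * L ^ 3 * (\<tau> * N)" by (simp add: power2_eq_square power3_eq_cube)
        finally have "8 * L * (t + 1) \<le> 96 * L ^ 3 * (\<tau> * N)" .
        moreover have "n < 8 * L + 8 * L * t" unfolding t_def using L(2) by (intro dividend_less_times_div) simp
        ultimately have nN: "n \<le> 96 * L ^ 3 * (\<tau> * N)" by simp
        from le_trans[OF n nN] have "L ^ 3 * (2 ^ 24 * r ^ 4) \<le> L ^ 3 * (96 * (\<tau> * N))"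
          by (simp add: algebra_simps)
        then have "2 ^ 24 * r ^ 4 \<le> 96 * (\<tau> * N)" using L(2) by simp
        then have rN: "131072 * r ^ 4 \<le> \<tau> * N" by (simp add: mult.commute)
        have r4: "1 \<le> r ^ 4" using r1 by simp
        have N0: "1 \<le> N" using rN r4 by (cases N) auto
        show ?thesis
        \<comment> \<open>A single group of this size is enough. Otherwise \<open>N\<close> is at
          least \<open>2\<close>.\<close>
        proof (cases "9 * (2 * r) ^ 4 \<le> \<tau>")
          case True
          then have "diff_rich (2 * r) n S" using rich(1)[of "2 * r"] N0 r1 by simp
          then show ?thesis using S3 by blast
        next
          case small: False
          then have "\<tau> < 144 * r ^ 4" by (simp add: power_mult_distrib)
          then have "N \<noteq> 1" using rN by auto
          then have N2: "2 \<le> N" using N0 by simp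
          \<comment> \<open>\<open>q\<close> is the largest number with
            \<open>9 * q ^ 4 \<le> \<tau>\<close>.\<close>
          define q where "q = (LEAST k. \<tau> < 9 * k ^ 4) - 1"
          have ex: "\<tau> < 9 * (2 * r) ^ 4" using small by simp
          then have Least: "\<tau> < 9 * (LEAST k. \<tau> < 9 * k ^ 4) ^ 4" by (rule LeastI)
          then have "(LEAST k. \<tau> < 9 * k ^ 4) \<noteq> 0" by (metis mult_zero_right not_less_zero power_0_left zero_neq_numeral)
          then have q_Suc: "(LEAST k. \<tau> < 9 * k ^ 4) = Suc q" by (simp add: q_def)
          have q1: "\<tau> < 9 * (Suc q) ^ 4" using Least unfolding q_Suc .
          have q2: "9 * q ^ 4 \<le> \<tau>" using not_less_Least[of q "\<lambda>k. \<tau> < 9 * k ^ 4"] unfolding q_Suc by simp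
          have "Suc q \<le> 2 * r" using Least_le[of "\<lambda>k. \<tau> < 9 * k ^ 4", OF ex] unfolding q_Suc .
          then have qr: "q < 2 * r" by simp
          show ?thesis
          \<comment> \<open>Naming the elements of a pair of windows costs about
            \<open>2 * L * q\<close> bits and gains about \<open>q\<^sup>2 / 2\<close>, so a
            \<open>q\<close> of order \<open>L\<close> is left to the progressions.\<close>
          proof (cases "q < 32 * L")
            case True
            then have "9 * (Suc q) ^ 4 \<le> 9 * (32 * L) ^ 4" by (intro mult_le_mono2 power_mono) auto
            also have "\<dots> \<le> 2 ^ 24 * L ^ 4" by (simp add: power_mult_distrib)
            finally have \<tau>L: "\<tau> \<le> 2 ^ 24 * L ^ 4" using q1 by linarith
            obtain J where J: "N * (N - 1) \<le> J * n" "prog_rich J n S" using rich(3) by blast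
            have "r\<^sup>2 + 2 * L + 2 \<le> J" using prog_length_ge[OF L(2) r n nN N2 \<tau>L J(1)] .
            then show ?thesis using prog_rich_mono[OF J(2)] S3 by blast
          next
            case False
            then have qL: "32 * L \<le> q" by simp
            then have q0: "1 \<le> q" using L(2) by linarith
            have "9 * (Suc q) ^ 4 \<le> 9 * (2 * q) ^ 4" using q0 by (intro mult_le_mono2 power_mono) auto
            then have "\<tau> \<le> 144 * q ^ 4" using q1 by (simp add: power_mult_distrib)
            \<comment> \<open>The second factor \<open>N\<close> is a weakening that makes the right
              side a square up to the constant, so that a root can be taken.\<close>
            then have "\<tau> * N \<le> 144 * q ^ 4 * (N * N)" using N0 by (intro mult_le_mono) auto
            then have "131072 * r ^ 4 \<le> 144 * (q ^ 4 * (N * N))" using rN by linarith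
            then have "900 * r ^ 4 \<le> q ^ 4 * (N * N)" by linarith
            then have "(30 * r\<^sup>2)\<^sup>2 \<le> (N * q\<^sup>2)\<^sup>2"
              by (simp add: power_mult_distrib power2_eq_square power4_eq_xxxx algebra_simps)
            then have "30 * r\<^sup>2 \<le> N * q\<^sup>2" by (rule power2_le_imp_le) simp
            also have "\<dots> \<le> (3 * (N div 2)) * q\<^sup>2" using N2 by (intro mult_le_mono1) linarith
            finally have "8 * r\<^sup>2 \<le> (N div 2) * q\<^sup>2" by (simp add: mult.commute)
            moreover have "N div 2 \<le> n" using Nn by linarith
            ultimately have "\<exists>g\<le>n. \<exists>q<2 * r. 32 * L \<le> q \<and> 8 * r\<^sup>2 \<le> g * q\<^sup>2 \<and> sum_rich g q n S"
              using rich(2)[OF q0 q2] qL qr by blast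
            then show ?thesis using S3 by blast
          qed
        qed
      qed
    qed
  qed blast
qed

text \<open>As \<open>32 * L \<le> q\<close>, the description costs at most
  \<open>g * q\<^sup>2 / 16\<close> bits besides \<open>L\<close>, while the core has nearly
  \<open>g * q\<^sup>2 / 2\<close> elements. What remains exceeds \<open>3 * r\<^sup>2\<close>,
  which pays for all other terms.\<close>

lemma sum_rich_exponent:
  fixes L g q r :: nat
  assumes "1 \<le> L" "32 * L \<le> q" "8 * r\<^sup>2 \<le> g * q\<^sup>2" "3 * L + 2 \<le> r\<^sup>2"
  shows "L + 2 * L * q * g + (2 * L + r\<^sup>2) \<le> g * (q\<^sup>2 div 2 - 1) - 2"
proof -
  have "32 \<le> q" using assms(1,2) by linarith
  then have "32 * 32 \<le> q * q" by (intro mult_le_mono)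
  then have q2: "1024 \<le> q\<^sup>2" by (simp add: power2_eq_square)
  then have a: "g * 1024 \<le> g * q\<^sup>2" by (rule mult_le_mono2)
  have "(32 * L) * q * g \<le> q * q * g" using assms(2) by (intro mult_le_mono1)
  then have b: "32 * (L * q * g) \<le> g * q\<^sup>2" by (simp add: power2_eq_square algebra_simps)
  have "g * q\<^sup>2 \<le> g * (2 * (q\<^sup>2 div 2 - 1) + 3)" using q2 by (intro mult_le_mono2) linarith
  then have "g * q\<^sup>2 \<le> 2 * (g * (q\<^sup>2 div 2 - 1)) + 3 * g" by (simp add: algebra_simps)
  moreover have "2 * L * q * g = 2 * (L * q * g)" by simp
  ultimately show ?thesis using a b assms(3,4) by linarith
qed

text \<open>Each of the five classes of \<open>cycle_sets_cases\<close> falls short of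
  \<open>2 ^ n\<close> by a factor of at least \<open>2 ^ r\<^sup>2\<close>.\<close>

lemma card_cycle_sets_le:
  assumes L: "n + 2 \<le> 2 ^ L" "1 \<le> L" and r: "2 ^ 30 * L ^ 6 \<le> r" and n: "2 ^ 24 * r ^ 4 * L ^ 3 \<le> n"
  shows "card (cycle_sets n) * 2 ^ r\<^sup>2 \<le> 5 * 2 ^ n"
proof -
  have "L * 1 \<le> L * L ^ 5" using L(2) by (intro mult_le_mono2) simp
  then have L6: "L \<le> L ^ 6" by (simp add: power_Suc[symmetric] del: power_Suc)
  then have rL: "100 * L \<le> r" using r by simp
  then have "r * (100 * L) \<le> r * r" by (rule mult_le_mono2)
  then have rr: "100 * (r * L) \<le> r\<^sup>2" by (simp add: power2_eq_square algebra_simps)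
  have r_rL: "r \<le> r * L" using L(2) by simp
  have "r\<^sup>2 * 1 \<le> r\<^sup>2 * (r\<^sup>2 * L ^ 3)" using rL L(2) by (intro mult_le_mono2) simp
  then have "r\<^sup>2 \<le> r ^ 4 * L ^ 3" by (simp add: power_add[symmetric] mult.assoc[symmetric])
  then have "2 ^ 24 * r\<^sup>2 \<le> 2 ^ 24 * (r ^ 4 * L ^ 3)" by (rule mult_le_mono2)
  then have "2 ^ 24 * r\<^sup>2 \<le> n" using n by (simp only: mult.assoc le_trans)
  then have rn: "4 * r\<^sup>2 \<le> n" by simp
  define A0 where "A0 = {S :: nat set. S \<subseteq> {3..n - r\<^sup>2}}"
  define A1 where "A1 = sparse_cycle_sets n (n div (8 * L))"
  define A2 where "A2 = {S. S \<subseteq> {3..n} \<and> diff_rich (2 * r) n S}"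
  define A3 where "A3 = {S. S \<subseteq> {3..n} \<and> prog_rich (r\<^sup>2 + 2 * L + 2) n S}"
  define Q where "Q = {(g, q). g \<le> n \<and> q < 2 * r \<and> 32 * L \<le> q \<and> 8 * r\<^sup>2 \<le> g * q\<^sup>2}"
  define F where "F = (\<lambda>(g, q). {S. S \<subseteq> {3..n} \<and> sum_rich g q n S})"
  define A4 where "A4 = (\<Union>x\<in>Q. F x)"
  have cancel: "c * 2 ^ b \<le> 2 ^ n" if "c * 2 ^ (a + b) \<le> 2 ^ a * 2 ^ n" for a b c :: nat
    using that by (simp add: power_add)
  have c0: "card A0 * 2 ^ r\<^sup>2 \<le> 2 ^ n"
  proof -
    have "A0 = Pow {3..n - r\<^sup>2}" by (auto simp: A0_def)
    then have "card A0 = 2 ^ card {3..n - r\<^sup>2}" by (simp add: card_Pow)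
    also have "\<dots> \<le> 2 ^ (n - r\<^sup>2)" by (intro power_increasing) auto
    finally have "card A0 * 2 ^ r\<^sup>2 \<le> 2 ^ (n - r\<^sup>2) * 2 ^ r\<^sup>2" by (rule mult_le_mono1)
    then show ?thesis using rn by (simp add: power_add[symmetric])
  qed
  have c1: "card A1 * 2 ^ r\<^sup>2 \<le> 2 ^ n"
  proof -
    have "card A1 * 2 ^ r\<^sup>2 \<le> 2 ^ (L + 2 * L * (n div (8 * L))) * 2 ^ r\<^sup>2"
      using card_sparse_cycle_sets[OF L(1)] by (intro mult_le_mono1) (simp add: A1_def)
    also have "\<dots> = 2 ^ (L + 2 * L * (n div (8 * L)) + r\<^sup>2)" by (simp add: power_add)
    also have "\<dots> \<le> 2 ^ n"
    proof (rule power_increasing)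
      \<comment> \<open>At \<open>2 * L\<close> bits for each edge, the edges of a sparse graph cost
        at most \<open>n / 4\<close> bits.\<close>
      have "8 * L * (n div (8 * L)) \<le> n" by simp
      moreover have "8 * L * (n div (8 * L)) = 4 * (2 * L * (n div (8 * L)))" by simp
      ultimately show "L + 2 * L * (n div (8 * L)) + r\<^sup>2 \<le> n" using rn rr r_rL rL by linarith
    qed simp
    finally show ?thesis .
  qed
  have c2: "card A2 * 2 ^ r\<^sup>2 \<le> 2 ^ n"
  proof (rule cancel)
    \<comment> \<open>The core has \<open>2 * r\<^sup>2\<close> elements, and half of this gain pays
      for its description.\<close>
    have "card A2 * 2 ^ (2 * r\<^sup>2) \<le> 2 ^ (2 * (L + 1) * (2 * r)) * 2 ^ n"
      unfolding A2_def by (rule card_diff_rich[OF L(1)]) (simp add: power_mult_distrib)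
    also have "\<dots> \<le> 2 ^ r\<^sup>2 * 2 ^ n"
    proof (intro mult_le_mono1 power_increasing)
      have "2 * (L + 1) * (2 * r) = 4 * (r * L) + 4 * r" by (simp add: algebra_simps)
      then show "2 * (L + 1) * (2 * r) \<le> r\<^sup>2" using rr r_rL by linarith
    qed simp
    finally show "card A2 * 2 ^ (r\<^sup>2 + r\<^sup>2) \<le> 2 ^ r\<^sup>2 * 2 ^ n" by (simp add: mult_2)
  qed
  have c3: "card A3 * 2 ^ r\<^sup>2 \<le> 2 ^ n"
    unfolding A3_def using card_prog_rich[OF L(1), of "r\<^sup>2 + 2 * L"] by (intro cancel[of _ "2 * L"]) (simp add: add.commute)
  have finQ: "finite Q" by (rule finite_subset[of _ "{..n} \<times> {..<2 * r}"]) (auto simp: Q_def)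
  have cQ: "card Q \<le> 2 ^ (2 * L)"
  proof -
    have "card Q \<le> card ({..n} \<times> {..<2 * r})" by (intro card_mono) (auto simp: Q_def)
    also have "\<dots> = (n + 1) * (2 * r)" by simp
    also have "\<dots> \<le> 2 ^ L * 2 ^ L"
    proof (intro mult_le_mono)
      show "2 * r \<le> 2 ^ L" using rr r_rL rn L(1) by linarith
    qed (use L(1) in simp)
    finally show ?thesis unfolding power_double .
  qed
  \<comment> \<open>The additional \<open>2 * L\<close> bits pay for the union over
    \<open>Q\<close>.\<close>
  have cF: "card (F x) * 2 ^ (2 * L + r\<^sup>2) \<le> 2 ^ n" if "x \<in> Q" for x
  proof -
    obtain g q where x: "x = (g, q)" by fastforce
    have gq: "32 * L \<le> q" "8 * r\<^sup>2 \<le> g * q\<^sup>2" using that x by (auto simp: Q_def)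
    have "32 \<le> q" using gq(1) L(2) by linarith
    then have "32 * 32 \<le> q * q" by (intro mult_le_mono)
    then have k: "2 * (q\<^sup>2 div 2 - 1 + 1) \<le> q\<^sup>2" by (simp add: power2_eq_square)
    have "L + 2 * L * q * g + (2 * L + r\<^sup>2) \<le> g * (q\<^sup>2 div 2 - 1) - 2"
      using L(2) gq rr r_rL rL by (intro sum_rich_exponent) linarith+
    then have "card (F x) * 2 ^ (L + 2 * L * q * g + (2 * L + r\<^sup>2)) \<le> card (F x) * 2 ^ (g * (q\<^sup>2 div 2 - 1) - 2)"
      by (intro mult_le_mono2 power_increasing) auto
    also have "\<dots> \<le> 2 ^ (L + 2 * L * q * g) * 2 ^ n"
      using card_sum_rich[OF L(1) k, of g] by (simp add: F_def x)
    finally show ?thesis by (rule cancel)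
  qed
  have c4: "card A4 * 2 ^ r\<^sup>2 \<le> 2 ^ n"
  proof (rule cancel)
    have "card A4 \<le> (\<Sum>x\<in>Q. card (F x))" unfolding A4_def using finQ by (rule card_UN_le)
    then have "card A4 * 2 ^ (2 * L + r\<^sup>2) \<le> (\<Sum>x\<in>Q. card (F x)) * 2 ^ (2 * L + r\<^sup>2)"
      by (rule mult_le_mono1)
    also have "\<dots> = (\<Sum>x\<in>Q. card (F x) * 2 ^ (2 * L + r\<^sup>2))" by (rule sum_distrib_right)
    also have "\<dots> \<le> (\<Sum>x\<in>Q. 2 ^ n)" by (intro sum_mono cF)
    also have "\<dots> \<le> 2 ^ (2 * L) * 2 ^ n" using cQ by simp
    finally show "card A4 * 2 ^ (2 * L + r\<^sup>2) \<le> 2 ^ (2 * L) * 2 ^ n" .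
  qed
  have fin: "finite A0" "finite A1" "finite A2" "finite A3" "finite A4"
    using card_sparse_cycle_sets[OF L(1)] finQ by (auto simp: A0_def A1_def A2_def A3_def A4_def F_def)
  have "cycle_sets n \<subseteq> A0 \<union> A1 \<union> A2 \<union> A3 \<union> A4"
  proof
    fix S assume "S \<in> cycle_sets n"
    from cycle_sets_cases[OF L r n this] show "S \<in> A0 \<union> A1 \<union> A2 \<union> A3 \<union> A4"
      unfolding A0_def A1_def A2_def A3_def A4_def F_def Q_def by blast
  qed
  then have "card (cycle_sets n) \<le> card (A0 \<union> A1 \<union> A2 \<union> A3 \<union> A4)" using fin by (intro card_mono) auto
  also have "\<dots> \<le> card A0 + card A1 + card A2 + card A3 + card A4"
    using card_Un_le[of A0 A1] card_Un_le[of "A0 \<union> A1" A2] card_Un_le[of "A0 \<union> A1 \<union> A2" A3]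
      card_Un_le[of "A0 \<union> A1 \<union> A2 \<union> A3" A4] by linarith
  finally have "card (cycle_sets n) * 2 ^ r\<^sup>2 \<le> (card A0 + card A1 + card A2 + card A3 + card A4) * 2 ^ r\<^sup>2"
    by (rule mult_le_mono1)
  then show ?thesis using c0 c1 c2 c3 c4 by (simp add: add_mult_distrib)
qed

section \<open>From the finite bound to the asymptotic one\<close>

lemma eventually_ln_bounds:
  "\<forall>\<^sub>F n in sequentially. 2 ^ 144 * (3 * ln (real n)) ^ 27 \<le> real n"
  "\<forall>\<^sub>F n in sequentially. 2 * ln (real n + 2) + 1 \<le> 3 * ln (real n)"
  "\<forall>\<^sub>F n in sequentially. 1 \<le> ln (real n)"
  by real_asymp+

lemma log2_le_two_ln:
  assumes "1 \<le> x"
  shows "log 2 x \<le> 2 * ln x"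
proof -
  have "1 \<le> ln (4::real)" using exp_le by (subst ln_ge_iff) auto
  also have "\<dots> = 2 * ln 2" using ln_realpow[of 2 2] by simp
  finally have "ln x * 1 \<le> ln x * (2 * ln 2)" using assms by (intro mult_left_mono) auto
  then show ?thesis by (simp add: log_def divide_le_eq)
qed

text \<open>The number \<open>r\<close> is taken as large as \<open>card_cycle_sets_le\<close>
  allows, so \<open>r\<^sup>2\<close> has the order of \<open>sqrt n\<close> divided by
  \<open>L\<close> to the power \<open>3 / 2\<close>.\<close>

lemma card_cycle_sets_le_powr:
  fixes n :: nat
  assumes big: "2 ^ 144 * (3 * ln (real n)) ^ 27 \<le> real n"
    and log: "2 * ln (real n + 2) + 1 \<le> 3 * ln (real n)" and ln: "1 \<le> ln (real n)"
  shows "real (card (cycle_sets n)) \<le> 2 powr (real n - (1 / 2 ^ 18) * sqrt (real n) / ln (real n) powr (3 / 2))"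
proof -
  define L where "L = Suc (floor_log (n + 2))"
  have L1: "1 \<le> L" by (simp add: L_def)
  have "n + 2 < 2 * 2 ^ floor_log (n + 2)" by (rule floor_log_exp2_gt)
  then have L2: "n + 2 \<le> 2 ^ L" by (simp add: L_def)
  have "real L \<le> log 2 (real n + 2) + 1"
  proof -
    have "(2::nat) ^ floor_log (n + 2) \<le> n + 2" by (rule floor_log_exp2_le) simp
    then have "real (2 ^ floor_log (n + 2)) \<le> real (n + 2)" by (rule of_nat_mono)
    then have "2 powr real (floor_log (n + 2)) \<le> real n + 2" by (simp add: powr_realpow)
    then have "real (floor_log (n + 2)) \<le> log 2 (real n + 2)" by (simp add: le_log_iff)
    then show ?thesis by (simp add: L_def)
  qed
  then have Lln: "real L \<le> 3 * ln (real n)" using log log2_le_two_ln[of "real n + 2"] by simp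
  define P where "P k \<longleftrightarrow> 2 ^ 24 * k ^ 4 * L ^ 3 \<le> n" for k
  have P0: "P (2 ^ 30 * L ^ 6)"
  proof -
    \<comment> \<open>The smallest admissible \<open>r\<close> satisfies the condition on
      \<open>n\<close>; the exponents are \<open>24 + 4 * 30 = 144\<close> and
      \<open>4 * 6 + 3 = 27\<close>.\<close>
    have "real (2 ^ 24 * (2 ^ 30 * L ^ 6) ^ 4 * L ^ 3) = 2 ^ 144 * real L ^ 27"
      by (simp add: power_mult_distrib power_mult[symmetric] power_add[symmetric])
    also have "\<dots> \<le> 2 ^ 144 * (3 * ln (real n)) ^ 27" using Lln by (intro mult_left_mono power_mono) auto
    finally have "real (2 ^ 24 * (2 ^ 30 * L ^ 6) ^ 4 * L ^ 3) \<le> real n" using big by linarith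
    then show ?thesis unfolding P_def by (simp only: of_nat_le_iff)
  qed
  have Pn: "k \<le> n" if "P k" for k
  proof -
    have "k * 1 \<le> k * k ^ 3" by (cases "k = 0") (simp_all add: Suc_le_eq)
    then have "k \<le> k ^ 4" by (simp add: power_Suc[symmetric] del: power_Suc)
    also have "\<dots> = 1 * k ^ 4 * 1" by simp
    also have "\<dots> \<le> 2 ^ 24 * k ^ 4 * L ^ 3" using L1 by (intro mult_le_mono) auto
    finally show ?thesis using that by (simp add: P_def)
  qed
  define r where "r = (GREATEST k. P k)"
  have Pr: "P r" unfolding r_def using P0 Pn by (rule GreatestI_nat)
  have rmax: "k \<le> r" if "P k" for k unfolding r_def using that Pn by (rule Greatest_le_nat)
  have r30: "2 ^ 30 * L ^ 6 \<le> r" by (rule rmax[OF P0])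
  moreover have "2 ^ 30 * 1 \<le> 2 ^ 30 * L ^ 6" using L1 by (intro mult_le_mono2) simp
  ultimately have r1: "3 \<le> r" by simp
  have count: "card (cycle_sets n) * 2 ^ r\<^sup>2 \<le> 5 * 2 ^ n"
    using card_cycle_sets_le[OF L2 L1 r30] Pr by (simp add: P_def)
  \<comment> \<open>Maximality of \<open>r\<close> yields the upper bound on \<open>n\<close>;
    replacing \<open>Suc r\<close> by \<open>2 * r\<close> costs a factor
    \<open>2 ^ 4\<close>.\<close>
  have "\<not> P (Suc r)" using rmax by fastforce
  then have "n \<le> 2 ^ 24 * (Suc r) ^ 4 * L ^ 3" by (simp add: P_def)
  also have "\<dots> \<le> 2 ^ 24 * (2 * r) ^ 4 * L ^ 3" using r1 by (intro mult_le_mono1 mult_le_mono2 power_mono) auto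
  finally have "real n \<le> real (2 ^ 24 * (2 * r) ^ 4 * L ^ 3)" by (rule of_nat_mono)
  also have "\<dots> = 2 ^ 28 * real r ^ 4 * real L ^ 3" by (simp add: power_mult_distrib)
  also have "\<dots> \<le> 2 ^ 28 * real r ^ 4 * (3 * ln (real n)) ^ 3" using Lln by (intro mult_left_mono power_mono) auto
  \<comment> \<open>The constant \<open>2 ^ 28 * 3 ^ 3\<close> is rounded up to a power of two with
    an even exponent.\<close>
  also have "\<dots> \<le> 2 ^ 34 * real r ^ 4 * ln (real n) ^ 3" using ln by (simp add: power_mult_distrib mult_right_mono)
  finally have "sqrt (real n) \<le> sqrt (2 ^ 34 * real r ^ 4 * ln (real n) ^ 3)" by (rule real_sqrt_le_mono)
  also have "\<dots> = 2 ^ 17 * (real r)\<^sup>2 * ln (real n) powr (3 / 2)"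
  proof (rule real_sqrt_unique)
    have "(ln (real n) powr (3 / 2))\<^sup>2 = ln (real n) powr 3"
      using ln by (simp add: power2_eq_square powr_add[symmetric])
    also have "\<dots> = ln (real n) ^ 3" using ln by (simp add: powr_numeral)
    finally show "(2 ^ 17 * (real r)\<^sup>2 * ln (real n) powr (3 / 2))\<^sup>2 = 2 ^ 34 * real r ^ 4 * ln (real n) ^ 3"
      by (simp add: power_mult_distrib)
  qed simp
  finally have "sqrt (real n) / ln (real n) powr (3 / 2) \<le> 2 ^ 17 * (real r)\<^sup>2"
    using ln by (simp add: divide_le_eq)
  then have "(1 / 2 ^ 18) * sqrt (real n) / ln (real n) powr (3 / 2) \<le> (real r)\<^sup>2 / 2" by simp
  \<comment> \<open>The factor \<open>5\<close> in the count is at most \<open>2 ^ 3\<close>. Half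
    of \<open>r\<^sup>2\<close> absorbs this \<open>3\<close>, which doubles \<open>2 ^ 17\<close>
    to \<open>2 ^ 18\<close>.\<close>
  also have "\<dots> \<le> (real r)\<^sup>2 - 3"
  proof -
    have "3 \<le> real r" using r1 by linarith
    then have "3 * 3 \<le> real r * real r" by (intro mult_mono) auto
    then show ?thesis by (simp add: power2_eq_square)
  qed
  finally have exponent: "real n + 3 - (real r)\<^sup>2 \<le> real n - (1 / 2 ^ 18) * sqrt (real n) / ln (real n) powr (3 / 2)"
    by linarith
  have "real (card (cycle_sets n) * 2 ^ r\<^sup>2) \<le> real (5 * 2 ^ n)" using count by (rule of_nat_mono)
  then have "real (card (cycle_sets n)) * 2 powr (real r)\<^sup>2 \<le> 5 * 2 powr real n"
    by (simp add: powr_realpow[symmetric])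
  also have "\<dots> \<le> 2 powr 3 * 2 powr real n" by (intro mult_right_mono) (simp_all add: powr_numeral)
  finally have "real (card (cycle_sets n)) \<le> 2 powr 3 * 2 powr real n / 2 powr (real r)\<^sup>2"
    by (simp add: le_divide_eq)
  also have "\<dots> = 2 powr (real n + 3 - (real r)\<^sup>2)" by (simp add: powr_diff powr_add)
  also have "\<dots> \<le> 2 powr (real n - (1 / 2 ^ 18) * sqrt (real n) / ln (real n) powr (3 / 2))"
    using exponent by (intro powr_mono) auto
  finally show ?thesis .
qed

theorem theorem1p1:
  shows "\<exists>c::real. c > 0 \<and> (\<exists>n0::nat. \<forall>n\<ge>n0.
           real (card (cycle_sets n)) \<le> 2 powr (real n - c * sqrt (real n) / ln (real n) powr (3/2)))"
proof -
  have "\<forall>\<^sub>F n in sequentially. real (card (cycle_sets n)) \<le>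
      2 powr (real n - (1 / 2 ^ 18) * sqrt (real n) / ln (real n) powr (3 / 2))"
    using eventually_ln_bounds by eventually_elim (rule card_cycle_sets_le_powr)
  then show ?thesis unfolding eventually_sequentially by (intro exI[of _ "1 / 2 ^ 18"]) simp
qed

end
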